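(* For every compact convex set $\Omega\subset\mathbb{C}$ with non-empty interior, the real and complex configuration constants coincide: $c_{\mathbb{R}}(\Omega)=c_{\mathbb{C}}(\Omega)$.
   Context: Let $\Omega\subset\mathbb{C}$ be a compact convex set with non-empty interior. Its boundary $\partial\Omega$ is a rectifiable simple closed curve, oriented counter-clockwise; $s$ denotes arclength measure on $\partial\Omega$. At every $\zeta\in\partial\Omega$ the one-sided tangent angles $\alpha_-(\zeta)\le\alpha_+(\zeta)$ (incoming and outgoing, with branches chosen so that $0\le\alpha_+(\zeta)-\alpha_-(\zeta)<\pi$) exist; $\zeta$ is called a corner if $\alpha_-(\zeta)<\alpha_+(\zeta)$, and there are at most countably many corners. Put $\theta_\zeta:=\pi-\alpha_+(\zeta)+\alpha_-(\zeta)\in(0,\pi]$ (the interior angle at $\zeta$; it equals $\pi$ if $\zeta$ is not a corner). At a non-corner $\sigma$ let $T(\sigma)$ be the unit tangent (in the positive direction) and $N(\sigma)=-iT(\sigma)$ the outward unit normal. For $\zeta\in\partial\Omega$ let $\mu_\zeta$ be the Borel probability measure on $\partial\Omega$ given by $d\mu_\zeta=(1-\theta_\zeta/\pi)\,d\delta_\zeta+\rho_\zeta\,ds$, where $\delta_\zeta$ is the unit point mass at $\zeta$ and $\rho_\zeta(\sigma)=\frac1\pi\operatorname{Re}\Big(\frac{N(\sigma)}{\sigma-\zeta}\Big)$ for non-corners $\sigma\ne\zeta$. Let $C(\partial\Omega)$ and $C_{\mathbb{R}}(\partial\Omega)$ be the spaces of complex-valued, respectively real-valued, continuous functions on $\partial\Omega$.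 The Neumann–Poincaré operator is $K_\Omega f(\zeta):=\int_{\partial\Omega}f\,d\mu_\zeta$, $\zeta\in\partial\Omega$. It maps each of these spaces into itself and fixes the constant function $\mathbf{1}$, so it acts on the quotients $C(\partial\Omega)/\mathbb{C}\mathbf{1}$ and $C_{\mathbb{R}}(\partial\Omega)/\mathbb{R}\mathbf{1}$, which are given the quotient norms $\|g+\mathbb{C}\mathbf{1}\|=\min_{\lambda\in\mathbb{C}}\max_{\zeta\in\partial\Omega}|g(\zeta)-\lambda|$ and $\|g+\mathbb{R}\mathbf{1}\|=\min_{r\in\mathbb{R}}\max_{\zeta\in\partial\Omega}|g(\zeta)-r|$. Define $c_{\mathbb{R}}(\Omega)$ to be the operator norm of $K_\Omega$ on $C_{\mathbb{R}}(\partial\Omega)/\mathbb{R}\mathbf{1}$, and $c_{\mathbb{C}}(\Omega)$ to be the operator norm of $K_\Omega$ on $C(\partial\Omega)/\mathbb{C}\mathbf{1}$. *)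

theory Defs
  imports "HOL-Analysis.Analysis"
begin

section \<open>The boundary curve and its arclength measure\<close>

definition center :: "complex set \<Rightarrow> complex" where
  "center \<Omega> = (SOME z. z \<in> interior \<Omega>)"

text \<open>
  The boundary of a compact convex set, traversed by the polar angle around an interior point.
  The parameter ranges over all of \<^typ>\<open>real\<close> with period \<open>2 * pi\<close>, so that every boundary
  point has parameters to either side of it.  All notions defined from the curve below are
  independent of the choice of the interior point.
\<close>

definition boundary_curve :: "complex set \<Rightarrow> real \<Rightarrow> complex" where
  "boundary_curve \<Omega> t =
     center \<Omega> + of_real (Sup {r. center \<Omega> + of_real r * cis t \<in> \<Omega>}) * cis t"

text \<open>The curve is a bijective parametrization of the boundary.\<close>

lemma boundary_curve_ray:
  assumes "compact \<Omega>" "convex \<Omega>" "interior \<Omega> \<noteq> {}"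
  defines "r \<equiv> \<lambda>t. Sup {r. center \<Omega> + of_real r * cis t \<in> \<Omega>}"
  shows "r t > 0" "boundary_curve \<Omega> t \<in> frontier \<Omega>"
    "\<And>s. 0 \<le> s \<Longrightarrow> s < r t \<Longrightarrow> center \<Omega> + of_real s * cis t \<in> interior \<Omega>"
    "\<And>s. r t < s \<Longrightarrow> center \<Omega> + of_real s * cis t \<notin> \<Omega>"
proof -
  define z where "z = center \<Omega>"
  define S where "S = {r. z + of_real r * cis t \<in> \<Omega>}"
  have z: "z \<in> interior \<Omega>"
    using assms(3) unfolding z_def center_def by (metis ex_in_conv someI_ex)
  have r: "r t = Sup S" by (simp add: r_def S_def z_def)
  have clS: "closed S"
  proof -
    have "S = (\<lambda>r. z + of_real r * cis t) -` \<Omega>" by (auto simp: S_def)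
    moreover have "continuous_on UNIV (\<lambda>r. z + of_real r * cis t)"
      by (intro continuous_intros)
    ultimately show ?thesis
      using continuous_closed_vimage[of \<Omega> "\<lambda>r. z + of_real r * cis t"] compact_imp_closed[OF assms(1)]
      by (simp add: continuous_on_eq_continuous_at)
  qed
  obtain B where B: "\<And>x. x \<in> \<Omega> \<Longrightarrow> norm x \<le> B"
    using assms(1) compact_imp_bounded bounded_iff by metis
  have "r \<le> B + norm z" if "r \<in> S" for r
  proof -
    have "norm (of_real r * cis t) \<le> norm (z + of_real r * cis t) + norm z"
      by (metis add.commute add_diff_cancel_left' norm_triangle_ineq4)
    then show ?thesis using B[of "z + of_real r * cis t"] that by (auto simp: S_def norm_mult)
  qed
  then have bdd: "bdd_above S" by (auto simp: bdd_above_def)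
  obtain e where e: "e > 0" "cball z e \<subseteq> \<Omega>"
    using z by (meson mem_interior_cball)
  have eS: "e \<in> S" using e by (auto simp: S_def dist_norm norm_mult subset_iff)
  have "e \<le> r t" unfolding r using eS bdd by (rule cSup_upper)
  then show pos: "r t > 0" using e by simp
  have inS: "r t \<in> S" unfolding r using closed_contains_Sup[OF _ bdd clS] eS by auto
  have out: "z + of_real s * cis t \<notin> \<Omega>" if "r t < s" for s
    using cSup_upper[OF _ bdd, of s] that unfolding r by (fastforce simp: S_def)
  have inn: "z + of_real s * cis t \<in> interior \<Omega>" if "0 \<le> s" "s < r t" for s
  proof (cases "s = 0")
    case False
    define c where "c = z + of_real (r t) * cis t"
    have c: "c \<in> closure \<Omega>" using inS closure_subset by (auto simp: S_def c_def)
    have "c - (1 - s / r t) *\<^sub>R (c - z) \<in> interior \<Omega>"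
      using mem_interior_closure_convex_shrink[OF assms(2) z c, of "1 - s / r t"] that False pos
      by simp
    moreover have "c - (1 - s / r t) *\<^sub>R (c - z) = z + of_real s * cis t"
      using pos by (simp add: c_def scaleR_conv_of_real field_simps)
    ultimately show ?thesis by simp
  qed (use z in simp)
  show "\<And>s. r t < s \<Longrightarrow> center \<Omega> + of_real s * cis t \<notin> \<Omega>" using out by (simp add: z_def)
  show "\<And>s. 0 \<le> s \<Longrightarrow> s < r t \<Longrightarrow> center \<Omega> + of_real s * cis t \<in> interior \<Omega>"
    using inn by (simp add: z_def)
  have "z + of_real (r t) * cis t \<notin> interior \<Omega>"
  proof
    assume "z + of_real (r t) * cis t \<in> interior \<Omega>"
    then obtain d where d: "d > 0" "cball (z + of_real (r t) * cis t) d \<subseteq> \<Omega>"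
      by (meson mem_interior_cball)
    have "z + of_real (r t + d) * cis t \<in> cball (z + of_real (r t) * cis t) d"
    proof -
      have "z + of_real (r t) * cis t - (z + of_real (r t + d) * cis t) = - (of_real d * cis t)"
        by (simp add: algebra_simps)
      then show ?thesis using d by (simp add: dist_norm norm_mult del: of_real_add)
    qed
    then have "z + of_real (r t + d) * cis t \<in> \<Omega>" using d(2) by blast
    then show False using d(1) out[of "r t + d"] by simp
  qed
  then show "boundary_curve \<Omega> t \<in> frontier \<Omega>"
    using inS closure_subset[of \<Omega>]
    by (auto simp: frontier_def boundary_curve_def S_def z_def r_def)
qed

lemma bij_betw_boundary_curve:
  assumes "compact \<Omega>" "convex \<Omega>" "interior \<Omega> \<noteq> {}"
  shows "bij_betw (boundary_curve \<Omega>) {0..<2 * pi} (frontier \<Omega>)"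
proof -
  define z where "z = center \<Omega>"
  define r where "r = (\<lambda>t. Sup {r. center \<Omega> + of_real r * cis t \<in> \<Omega>})"
  have r: "Sup {r. center \<Omega> + of_real r * cis t \<in> \<Omega>} = r t" for t
    by (simp add: r_def)
  note ray = boundary_curve_ray[OF assms, unfolded r]
  have curve: "boundary_curve \<Omega> t = z + of_real (r t) * cis t" for t
    by (simp add: boundary_curve_def z_def r_def)
  have arg: "Arg2pi (boundary_curve \<Omega> t - z) = t" if "t \<in> {0..<2 * pi}" for t
    by (rule Arg2pi_unique[where r = "r t"])
      (use that ray(1)[of t] in \<open>simp_all add: curve cis_conv_exp[symmetric]\<close>)
  have "w \<in> boundary_curve \<Omega> ` {0..<2 * pi}" if "w \<in> frontier \<Omega>" for w
  proof -
    define t where "t = Arg2pi (w - z)"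
    have t: "t \<in> {0..<2 * pi}" by (simp add: t_def Arg2pi_ge_0 Arg2pi_lt_2pi)
    have w: "w = z + of_real (norm (w - z)) * cis t"
      using Arg2pi_eq[of "w - z"] by (simp add: t_def cis_conv_exp)
    have "w \<in> \<Omega>" "w \<notin> interior \<Omega>"
      using that compact_imp_closed[OF assms(1)] by (auto simp: frontier_def)
    then have "norm (w - z) = r t"
      using ray(3)[of "norm (w - z)" t] ray(4)[of t "norm (w - z)"] w
      by (metis linorder_neqE_linordered_idom norm_ge_zero z_def)
    then show ?thesis using t w curve by auto
  qed
  then show ?thesis
    using arg ray(2) by (auto simp: bij_betw_def intro!: inj_on_inverseI[of _ "\<lambda>w. Arg2pi (w - z)"])
qed

definition boundary_param :: "complex set \<Rightarrow> complex \<Rightarrow> real" where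
  "boundary_param \<Omega> = inv_into {0..<2 * pi} (boundary_curve \<Omega>)"

definition curve_length :: "(real \<Rightarrow> complex) \<Rightarrow> real \<Rightarrow> real \<Rightarrow> real" where
  "curve_length \<gamma> a b =
     Sup {(\<Sum>i<n. dist (\<gamma> (p i)) (\<gamma> (p (Suc i)))) | (p :: nat \<Rightarrow> real) n.
            mono p \<and> p 0 = a \<and> p n = b}"

text \<open>
  Arclength measure is the image under the curve of the Lebesgue--Stieltjes measure of the length
  function.  The length function is extended by constants outside \<open>[0, 2 * pi]\<close>, so
  the boundary is traversed exactly once.
\<close>

definition arclength :: "complex set \<Rightarrow> complex measure" where
  "arclength \<Omega> =
     distr (interval_measure (\<lambda>t. curve_length (boundary_curve \<Omega>) 0 (max 0 (min t (2 * pi)))))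
       (restrict_space borel (frontier \<Omega>)) (boundary_curve \<Omega>)"

section \<open>Tangents, corners and normals\<close>

definition tangent_in :: "complex set \<Rightarrow> complex \<Rightarrow> complex" where
  "tangent_in \<Omega> \<zeta> =
     (let \<gamma> = boundary_curve \<Omega>; t = boundary_param \<Omega> \<zeta>
      in Lim (at_left t) (\<lambda>u. sgn (\<gamma> t - \<gamma> u)))"

definition tangent_out :: "complex set \<Rightarrow> complex \<Rightarrow> complex" where
  "tangent_out \<Omega> \<zeta> =
     (let \<gamma> = boundary_curve \<Omega>; t = boundary_param \<Omega> \<zeta>
      in Lim (at_right t) (\<lambda>u. sgn (\<gamma> u - \<gamma> t)))"

definition alpha_minus :: "complex set \<Rightarrow> complex \<Rightarrow> real" where
  "alpha_minus \<Omega> \<zeta> = Arg (tangent_in \<Omega> \<zeta>)"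

definition alpha_plus :: "complex set \<Rightarrow> complex \<Rightarrow> real" where
  "alpha_plus \<Omega> \<zeta> =
     (THE a. cis a = tangent_out \<Omega> \<zeta> \<and> 0 \<le> a - alpha_minus \<Omega> \<zeta> \<and> a - alpha_minus \<Omega> \<zeta> < pi)"

definition corner :: "complex set \<Rightarrow> complex \<Rightarrow> bool" where
  "corner \<Omega> \<zeta> \<longleftrightarrow> alpha_minus \<Omega> \<zeta> < alpha_plus \<Omega> \<zeta>"

definition interior_angle :: "complex set \<Rightarrow> complex \<Rightarrow> real" where
  "interior_angle \<Omega> \<zeta> = pi - alpha_plus \<Omega> \<zeta> + alpha_minus \<Omega> \<zeta>"

definition outward_normal :: "complex set \<Rightarrow> complex \<Rightarrow> complex" where
  "outward_normal \<Omega> \<sigma> = - \<i> * tangent_out \<Omega> \<sigma>"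

section \<open>The Neumann--Poincare operator\<close>

text \<open>
  The value 0 at corners and at \<open>\<zeta>\<close> itself is immaterial, since these points form a countable
  set, which is null for arclength.
\<close>

definition np_density :: "complex set \<Rightarrow> complex \<Rightarrow> complex \<Rightarrow> real" where
  "np_density \<Omega> \<zeta> \<sigma> =
     (if corner \<Omega> \<sigma> \<or> \<sigma> = \<zeta> then 0 else 1 / pi * Re (outward_normal \<Omega> \<sigma> / (\<sigma> - \<zeta>)))"

definition np_measure :: "complex set \<Rightarrow> complex \<Rightarrow> complex measure" where
  "np_measure \<Omega> \<zeta> =
     measure_of (frontier \<Omega>) (sets (restrict_space borel (frontier \<Omega>)))
       (\<lambda>A. ennreal (1 - interior_angle \<Omega> \<zeta> / pi)
               * indicator A \<zeta>
             + emeasure (density (arclength \<Omega>) (\<lambda>\<sigma>. ennreal (np_density \<Omega> \<zeta> \<sigma>))) A)"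

definition neumann_poincare ::
  "complex set \<Rightarrow> (complex \<Rightarrow> 'a::{banach, second_countable_topology}) \<Rightarrow> complex \<Rightarrow> 'a" where
  "neumann_poincare \<Omega> f \<zeta> = (\<integral>\<sigma>. f \<sigma> \<partial>np_measure \<Omega> \<zeta>)"

section \<open>The configuration constants\<close>

text \<open>
  The norm of the class of \<open>g\<close> modulo the constant functions, for real- and complex-valued \<open>g\<close>
  alike: the constant ranges over the type of values of \<open>g\<close>.
\<close>

definition quotient_norm :: "complex set \<Rightarrow> (complex \<Rightarrow> 'a::real_normed_vector) \<Rightarrow> real" where
  "quotient_norm X g = (INF c. SUP \<zeta>\<in>X. norm (g \<zeta> - c))"

definition c_real :: "complex set \<Rightarrow> real" where
  "c_real \<Omega> =
     (SUP f\<in>{f :: complex \<Rightarrow> real. continuous_on (frontier \<Omega>) f \<and> quotient_norm (frontier \<Omega>) f \<le> 1}.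
        quotient_norm (frontier \<Omega>) (neumann_poincare \<Omega> f))"

definition c_complex :: "complex set \<Rightarrow> real" where
  "c_complex \<Omega> =
     (SUP f\<in>{f :: complex \<Rightarrow> complex. continuous_on (frontier \<Omega>) f \<and> quotient_norm (frontier \<Omega>) f \<le> 1}.
        quotient_norm (frontier \<Omega>) (neumann_poincare \<Omega> f))"

end

theory Submission
  imports Defs
begin

text \<open>
  For a family of measures of equal mass, let \<open>b\<close> bound the real constant, so that
  \<open>\<bar>\<integral>u d\<mu>\<^sub>x - \<integral>u d\<mu>\<^sub>y\<bar> \<le> 2b\<close> for real \<open>\<bar>u\<bar> \<le> 1\<close>.  By Helly's theorem and convex duality, the
  averages of a complex \<open>\<bar>g\<bar> \<le> 1\<close> lie in a disc of radius \<open>b\<close> provided that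
  \<open>\<bar>w\<^sub>1 \<integral>g d\<mu>\<^sub>1 + w\<^sub>2 \<integral>g d\<mu>\<^sub>2 + w\<^sub>3 \<integral>g d\<mu>\<^sub>3\<bar> \<le> b (\<bar>w\<^sub>1\<bar> + \<bar>w\<^sub>2\<bar> + \<bar>w\<^sub>3\<bar>)\<close> whenever \<open>w\<^sub>1 + w\<^sub>2 + w\<^sub>3 = 0\<close>.
  The moduli \<open>\<bar>w\<^sub>i\<bar>\<close> are the sides of a triangle, so \<open>2k\<^sub>i\<^sub>j = \<bar>w\<^sub>i\<bar> + \<bar>w\<^sub>j\<bar> - \<bar>w\<^sub>k\<bar>\<close> is nonnegative, and
  \<open>\<bar>\<Sum> w\<^sub>i x\<^sub>i\<bar> \<le> \<Sum> k\<^sub>i\<^sub>j \<bar>x\<^sub>i - x\<^sub>j\<bar>\<close> for real \<open>x\<^sub>i\<close>.  Summed over the cells of a fine partition of unity,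
  this reduces the complex inequality to the real one for the three pairs.

  The masses are equal as soon as the real constant is finite: otherwise large constant functions,
  which vanish in the quotient, would have arbitrarily large images.  What is needed of the geometry is
  thus only that the masses are uniformly bounded.  This holds because the density is dominated by the
  derivative of the angle under which the boundary is seen from the point, and that angle is monotone.
\<close>

section \<open>Families of measures with pairwise bounded differences\<close>

text \<open>Summation by parts: eliminating \<open>w2\<close> leaves the gaps between consecutive
  values, with coefficients \<open>w1\<close> and \<open>- w3\<close>.\<close>

lemma norm_weighted_sum_sorted:
  fixes w1 w2 w3 :: complex and x1 x2 x3 :: real
  assumes "w1 + w2 + w3 = 0" "x1 \<ge> x2" "x2 \<ge> x3"
  shows "norm (of_real x1 * w1 + of_real x2 * w2 + of_real x3 * w3)
    \<le> (x1 - x2) * norm w1 + (x2 - x3) * norm w3"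
proof -
  have w2: "w2 = - w1 - w3" using assms(1) by (simp add: algebra_simps eq_neg_iff_add_eq_0)
  have "of_real x1 * w1 + of_real x2 * w2 + of_real x3 * w3
      = of_real (x1 - x2) * w1 - of_real (x2 - x3) * w3"
    unfolding w2 by (simp add: algebra_simps)
  also have "norm \<dots> \<le> norm (of_real (x1 - x2) * w1) + norm (of_real (x2 - x3) * w3)"
    by (rule norm_triangle_ineq4)
  also have "\<dots> = (x1 - x2) * norm w1 + (x2 - x3) * norm w3"
    using assms(2,3) by (simp add: norm_mult del: of_real_diff)
  finally show ?thesis .
qed

text \<open>When \<open>x1\<close>, \<open>x2\<close>, \<open>x3\<close> decrease, writing
  \<open>x1 - x3\<close> as \<open>(x1 - x2) + (x2 - x3)\<close> collapses the right-hand side to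
  exactly twice the bound for sorted values. Both sides are invariant under simultaneous permutation
  of weights and values, so the other five orders follow.\<close>

lemma norm_weighted_sum_le:
  fixes w1 w2 w3 :: complex and x1 x2 x3 :: real
  assumes w: "w1 + w2 + w3 = 0"
  shows "2 * norm (of_real x1 * w1 + of_real x2 * w2 + of_real x3 * w3)
    \<le> (norm w1 + norm w2 - norm w3) * \<bar>x1 - x2\<bar>
      + (norm w1 + norm w3 - norm w2) * \<bar>x1 - x3\<bar>
      + (norm w2 + norm w3 - norm w1) * \<bar>x2 - x3\<bar>"
proof -
  consider "x1 \<ge> x2" "x2 \<ge> x3" | "x1 \<ge> x3" "x3 \<ge> x2" | "x2 \<ge> x1" "x1 \<ge> x3"
    | "x2 \<ge> x3" "x3 \<ge> x1" | "x3 \<ge> x1" "x1 \<ge> x2" | "x3 \<ge> x2" "x2 \<ge> x1"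
    by linarith
  then show ?thesis
  proof cases
    case 1
    have "w1 + w2 + w3 = 0" using w by (simp add: ac_simps)
    from norm_weighted_sum_sorted[OF this 1] show ?thesis
      using 1 by (simp add: abs_of_nonneg abs_of_nonpos algebra_simps)
  next
    case 2
    have "w1 + w3 + w2 = 0" using w by (simp add: ac_simps)
    from norm_weighted_sum_sorted[OF this 2] show ?thesis
      using 2 by (simp add: abs_of_nonneg abs_of_nonpos algebra_simps)
  next
    case 3
    have "w2 + w1 + w3 = 0" using w by (simp add: ac_simps)
    from norm_weighted_sum_sorted[OF this 3] show ?thesis
      using 3 by (simp add: abs_of_nonneg abs_of_nonpos algebra_simps)
  next
    case 4
    have "w2 + w3 + w1 = 0" using w by (simp add: ac_simps)
    from norm_weighted_sum_sorted[OF this 4] show ?thesis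
      using 4 by (simp add: abs_of_nonneg abs_of_nonpos algebra_simps)
  next
    case 5
    have "w3 + w1 + w2 = 0" using w by (simp add: ac_simps)
    from norm_weighted_sum_sorted[OF this 5] show ?thesis
      using 5 by (simp add: abs_of_nonneg abs_of_nonpos algebra_simps)
  next
    case 6
    have "w3 + w2 + w1 = 0" using w by (simp add: ac_simps)
    from norm_weighted_sum_sorted[OF this 6] show ?thesis
      using 6 by (simp add: abs_of_nonneg abs_of_nonpos algebra_simps)
  qed
qed

section \<open>Common points of discs\<close>

text \<open>The balls share a point iff the affine space \<open>T\<close> of triples
  \<open>(c - p1, c - p2, c - p3)\<close> meets the product \<open>S\<close> of three balls around
  0. Otherwise a hyperplane separates \<open>S\<close> from \<open>T\<close>, and the three
  components of its normal violate \<open>dual\<close>.\<close>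

lemma common_point_three_cballs:
  fixes p1 p2 p3 :: "'a::euclidean_space"
  assumes "\<rho> \<ge> 0"
    and dual: "\<And>a1 a2 a3. a1 + a2 + a3 = 0 \<Longrightarrow>
      \<bar>inner a1 p1 + inner a2 p2 + inner a3 p3\<bar> \<le> \<rho> * (norm a1 + norm a2 + norm a3)"
  shows "cball p1 \<rho> \<inter> cball p2 \<rho> \<inter> cball p3 \<rho> \<noteq> {}"
proof
  assume empty: "cball p1 \<rho> \<inter> cball p2 \<rho> \<inter> cball p3 \<rho> = {}"
  define S where "S = cball (0::'a) \<rho> \<times> cball (0::'a) \<rho> \<times> cball (0::'a) \<rho>"
  define D where "D = range (\<lambda>c::'a. (c, c, c))"
  define T where "T = (+) (- p1, - p2, - p3) ` D"
  have "subspace D"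
    unfolding D_def by (intro linear_subspace_image linearI) auto
  then have T: "convex T" "closed T"
    unfolding T_def by (auto intro: convex_translation subspace_imp_convex
        closed_translation closed_subspace)
  have S: "convex S" "compact S" "S \<noteq> {}"
    using assms(1) by (auto simp: S_def intro!: convex_Times compact_Times)
  have "S \<inter> T = {}"
  proof (rule ccontr)
    assume "S \<inter> T \<noteq> {}"
    then obtain c where "norm (c - p1) \<le> \<rho>" "norm (c - p2) \<le> \<rho>" "norm (c - p3) \<le> \<rho>"
      by (auto simp: S_def T_def D_def)
    then have "c \<in> cball p1 \<rho> \<inter> cball p2 \<rho> \<inter> cball p3 \<rho>" by (simp add: dist_norm norm_minus_commute)
    then show False using empty by blast
  qed
  then obtain a \<beta> where a: "\<And>x. x \<in> S \<Longrightarrow> inner a x < \<beta>" "\<And>x. x \<in> T \<Longrightarrow> inner a x > \<beta>"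
    using separating_hyperplane_compact_closed[OF S T] by blast
  obtain a1 a2 a3 where a_eq: "a = (a1, a2, a3)" by (cases a)
  define v where "v = a1 + a2 + a3"
  define k where "k = inner a1 p1 + inner a2 p2 + inner a3 p3"
  have gt: "inner v c - k > \<beta>" for c
  proof -
    have "(c - p1, c - p2, c - p3) = (- p1, - p2, - p3) + (c, c, c)" by simp
    then have "(c - p1, c - p2, c - p3) \<in> T" unfolding T_def D_def by blast
    then show ?thesis
      using a(2) by (force simp: a_eq v_def k_def inner_diff_right inner_add_left)
  qed
  \<comment> \<open>On \<open>T\<close> the functional is \<open>inner v c - k\<close>, which for
    nonzero \<open>v\<close> would take the excluded value \<open>\<beta>\<close> at a suitable
    multiple of \<open>v\<close>.\<close>
  have v: "v = 0"
  proof (rule ccontr)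
    assume "v \<noteq> 0"
    then show False using gt[of "((\<beta> + k) / (norm v)\<^sup>2) *\<^sub>R v"]
      by (simp add: power2_norm_eq_inner)
  qed
  have sgn: "inner x (\<rho> *\<^sub>R sgn x) = \<rho> * norm x" "norm (\<rho> *\<^sub>R sgn x) \<le> \<rho>" for x :: 'a
  proof -
    show "inner x (\<rho> *\<^sub>R sgn x) = \<rho> * norm x"
      by (cases "x = 0") (auto simp: sgn_div_norm dot_square_norm power2_eq_square)
    show "norm (\<rho> *\<^sub>R sgn x) \<le> \<rho>"
      using assms(1) by (simp add: norm_sgn)
  qed
  \<comment> \<open>This triple maximises the functional over \<open>S\<close>.\<close>
  have "(\<rho> *\<^sub>R sgn a1, \<rho> *\<^sub>R sgn a2, \<rho> *\<^sub>R sgn a3) \<in> S"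
    using sgn(2) by (simp add: S_def)
  then have "\<rho> * (norm a1 + norm a2 + norm a3) < \<beta>"
    using a(1) sgn(1) by (fastforce simp: a_eq algebra_simps simp del: inner_scaleR_right)
  moreover have "\<beta> < - k" using gt[of 0] by simp
  ultimately show False using dual[of a1 a2 a3] v by (simp add: v_def k_def)
qed

text \<open>Repetitions among \<open>a\<close>, \<open>b\<close>, \<open>c\<close> are allowed, so
  that a hypothesis on three balls also covers families of one or two.\<close>

lemma card_le_3_obtains:
  assumes "finite F" "F \<noteq> {}" "card F \<le> 3"
  obtains a b c where "F = {a, b, c}"
proof -
  obtain a where a: "a \<in> F" using assms(2) by blast
  have "card (F - {a}) \<le> 2" using a assms by simp
  then consider "card (F - {a}) = 0" | "card (F - {a}) = 1" | "card (F - {a}) = 2" by linarith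
  then show thesis
  proof cases
    case 1
    then have "F - {a} = {}" using assms(1) by (meson card_0_eq finite_Diff)
    then have "F = {a, a, a}" using a by auto
    then show thesis by (rule that)
  next
    case 2
    then obtain b where "F - {a} = {b}" by (auto simp: card_1_singleton_iff)
    then have "F = {a, b, b}" using a by auto
    then show thesis by (rule that)
  next
    case 3
    then obtain b c where "F - {a} = {b, c}" by (auto simp: card_2_iff)
    then have "F = {a, b, c}" using a by auto
    then show thesis by (rule that)
  qed
qed

text \<open>Helly's theorem in the plane passes from three discs to finitely many; compactness of
  one disc then passes to the whole family.\<close>

lemma common_point_cballs:
  fixes p :: "'b \<Rightarrow> complex"
  assumes three: "\<And>x y z. x \<in> X \<Longrightarrow> y \<in> X \<Longrightarrow> z \<in> X \<Longrightarrow>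
    cball (p x) \<rho> \<inter> cball (p y) \<rho> \<inter> cball (p z) \<rho> \<noteq> {}"
  shows "\<exists>c. \<forall>x\<in>X. norm (p x - c) \<le> \<rho>"
proof (cases "X = {}")
  case False
  then obtain x0 where x0: "x0 \<in> X" by blast
  define \<F> where "\<F> = (\<lambda>x. cball (p x) \<rho>) ` X"
  have few: "\<Inter>t \<noteq> {}" if t: "t \<subseteq> \<F>" "finite t" "card t \<le> 3" for t
  proof (cases "t = {}")
    case False
    then obtain a b c where abc: "t = {a, b, c}" using card_le_3_obtains t by metis
    then obtain x y z where "x \<in> X" "y \<in> X" "z \<in> X" "a = cball (p x) \<rho>" "b = cball (p y) \<rho>"
      "c = cball (p z) \<rho>" using t(1) by (auto simp: \<F>_def)
    then show ?thesis using three[of x y z] abc by auto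
  qed auto
  have finite_Int: "\<Inter>t \<noteq> {}" if t: "t \<subseteq> \<F>" "finite t" for t
  proof (cases "card t \<le> 3")
    case True
    then show ?thesis using few t by blast
  next
    case False
    have three: "\<Inter>u \<noteq> {}" if "u \<subseteq> t" "card u = DIM(complex) + 1" for u
      using that t by (intro few) (auto intro: finite_subset)
    have "\<forall>s\<in>t. convex s" using t by (auto simp: \<F>_def)
    moreover have "card t \<ge> DIM(complex) + 1" using False by simp
    ultimately show ?thesis using three Helly by blast
  qed
  have "cball (p x0) \<rho> \<inter> \<Inter>\<F> \<noteq> {}"
  proof (rule compact_imp_fip[OF compact_cball])
    show "closed T" if "T \<in> \<F>" for T using that by (auto simp: \<F>_def)
    show "cball (p x0) \<rho> \<inter> \<Inter>\<G> \<noteq> {}" if "finite \<G>" "\<G> \<subseteq> \<F>" for \<G>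
    proof -
      have "\<Inter>(insert (cball (p x0) \<rho>) \<G>) \<noteq> {}"
        using that x0 by (intro finite_Int) (auto simp: \<F>_def)
      then show ?thesis by simp
    qed
  qed
  then obtain c where "c \<in> \<Inter>\<F>" by blast
  then show ?thesis by (auto simp: \<F>_def dist_norm)
qed auto

text \<open>The weights are tents of radius \<open>\<epsilon>\<close> around finitely many values of
  \<open>g\<close>, normalised by their sum. Choosing the nodes among the values of \<open>g\<close>
  makes them inherit every bound on \<open>g\<close>.\<close>

lemma partition_of_unity_along:
  fixes g :: "'a::topological_space \<Rightarrow> 'b::real_normed_vector"
  assumes "compact X" "continuous_on X g" "\<epsilon> > 0"
  obtains C \<phi> where "finite C" "C \<subseteq> g ` X" "\<And>c. continuous_on X (\<phi> c)"
    "\<And>c x. x \<in> X \<Longrightarrow> \<phi> c x \<ge> (0::real)" "\<And>x. x \<in> X \<Longrightarrow> (\<Sum>c\<in>C. \<phi> c x) = 1"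
    "\<And>x. x \<in> X \<Longrightarrow> norm (g x - (\<Sum>c\<in>C. \<phi> c x *\<^sub>R c)) \<le> \<epsilon>"
proof -
  have "g ` X \<subseteq> (\<Union>c\<in>g ` X. ball c \<epsilon>)" using assms(3) by auto
  then obtain C where C: "finite C" "C \<subseteq> g ` X" "g ` X \<subseteq> (\<Union>c\<in>C. ball c \<epsilon>)"
    by (rule compactE_image[OF compact_continuous_image[OF assms(2,1)], of "g ` X" "\<lambda>c. ball c \<epsilon>", rotated]) auto
  define d where "d c x = max 0 (\<epsilon> - norm (g x - c))" for c x
  define s where "s x = (\<Sum>c\<in>C. d c x)" for x
  define \<phi> where "\<phi> c x = d c x / s x" for c x
  have s: "s x > 0" if x: "x \<in> X" for x
  proof -
    obtain c where c: "c \<in> C" "norm (g x - c) < \<epsilon>"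
      using C(3) x by (force simp: dist_norm norm_minus_commute)
    then show ?thesis unfolding s_def
      by (intro sum_pos2[of _ c]) (auto simp: C d_def)
  qed
  have cont_d: "continuous_on X (d c)" for c
    unfolding d_def by (intro continuous_intros assms)
  then have "continuous_on X s" unfolding s_def by (intro continuous_intros)
  moreover have "\<forall>x\<in>X. s x \<noteq> 0" using s by fastforce
  ultimately have cont: "continuous_on X (\<phi> c)" for c
    unfolding \<phi>_def by (intro continuous_intros cont_d) auto
  have pos: "\<phi> c x \<ge> 0" if "x \<in> X" for c x
    using s[OF that] by (simp add: \<phi>_def d_def)
  have one: "(\<Sum>c\<in>C. \<phi> c x) = 1" if "x \<in> X" for x
    using s[OF that] by (simp add: \<phi>_def sum_divide_distrib[symmetric] s_def[symmetric])
  have close: "norm (g x - (\<Sum>c\<in>C. \<phi> c x *\<^sub>R c)) \<le> \<epsilon>" if x: "x \<in> X" for x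
  proof -
    have "g x - (\<Sum>c\<in>C. \<phi> c x *\<^sub>R c) = (\<Sum>c\<in>C. \<phi> c x *\<^sub>R (g x - c))"
      by (simp add: scaleR_diff_right sum_subtractf scaleR_left.sum[symmetric] one[OF x])
    also have "norm \<dots> \<le> (\<Sum>c\<in>C. \<phi> c x * norm (g x - c))"
      using pos[OF x] by (intro order_trans[OF norm_sum]) (simp add: abs_of_nonneg)
    also have "\<dots> \<le> (\<Sum>c\<in>C. \<phi> c x * \<epsilon>)"
    proof (rule sum_mono)
      fix c assume "c \<in> C"
      \<comment> \<open>Where \<open>g x\<close> is farther than \<open>\<epsilon>\<close> from
        \<open>c\<close>, the tent and hence both sides vanish.\<close>
      show "\<phi> c x * norm (g x - c) \<le> \<phi> c x * \<epsilon>"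
        using s[OF x] pos[OF x, of c]
        by (cases "norm (g x - c) \<le> \<epsilon>") (auto simp: \<phi>_def d_def intro!: mult_left_mono divide_right_mono)
    qed
    also have "\<dots> = \<epsilon>" by (simp add: sum_distrib_right[symmetric] one[OF x])
    finally show ?thesis .
  qed
  show thesis by (rule that[OF C(1,2) cont pos one close])
qed

section \<open>Averages over a kernel of bounded mass\<close>

text \<open>This collects what the comparison of the two constants uses of
  \<open>np_measure\<close>: Borel measures on a compact set whose masses have a common finite
  bound.\<close>

locale bounded_kernel =
  fixes X :: "complex set" and \<mu> :: "complex \<Rightarrow> complex measure" and B :: real
  assumes compact: "compact X" and nonempty: "X \<noteq> {}"
    and sets_kernel [measurable_cong]: "\<And>x. sets (\<mu> x) = sets (restrict_space borel X)"
    and mass_le: "\<And>x. x \<in> X \<Longrightarrow> emeasure (\<mu> x) X \<le> ennreal B"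
begin

lemma space_kernel [simp]: "space (\<mu> x) = X"
  using sets_eq_imp_space_eq[OF sets_kernel, of x] by (simp add: space_restrict_space)

lemma finite_measure_kernel: "x \<in> X \<Longrightarrow> finite_measure (\<mu> x)"
  using mass_le[of x] by (intro finite_measureI) (auto simp: top_unique)

text \<open>The maximum appears because \<open>ennreal\<close> sends a negative \<open>B\<close> to
  0.\<close>

lemma measure_kernel_le: "x \<in> X \<Longrightarrow> measure (\<mu> x) X \<le> max B 0"
  using mass_le[of x] finite_measure_kernel[of x]
  by (simp add: finite_measure.emeasure_eq_measure ennreal_le_iff2) linarith

lemma bounded_on:
  fixes f :: "complex \<Rightarrow> 'a::real_normed_vector"
  assumes "continuous_on X f"
  obtains R where "R \<ge> 0" "\<And>x. x \<in> X \<Longrightarrow> norm (f x) \<le> R"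
proof -
  obtain R where "\<And>x. x \<in> X \<Longrightarrow> norm (f x) \<le> R"
    using compact_imp_bounded[OF compact_continuous_image[OF assms compact]]
    by (auto simp: bounded_iff)
  then show thesis using that[of "max R 0"] by fastforce
qed

lemma integrable_kernel:
  fixes f :: "complex \<Rightarrow> 'a::{banach,second_countable_topology}"
  assumes "x \<in> X" "continuous_on X f"
  shows "integrable (\<mu> x) f"
proof -
  obtain R where R: "\<And>x. x \<in> X \<Longrightarrow> norm (f x) \<le> R" using bounded_on[OF assms(2)] by metis
  have "f \<in> borel_measurable (\<mu> x)"
    using borel_measurable_continuous_on_restrict[OF assms(2)]
      measurable_cong_sets[OF sets_kernel refl, of x] by blast
  then show ?thesis
    using R by (intro finite_measure.integrable_const_bound[OF finite_measure_kernel[OF assms(1)], of _ R])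
      auto
qed

lemma norm_integral_kernel_le:
  fixes f :: "complex \<Rightarrow> 'a::{banach,second_countable_topology}"
  assumes "x \<in> X" "continuous_on X f" "\<And>y. y \<in> X \<Longrightarrow> norm (f y) \<le> R" "R \<ge> 0"
  shows "norm (\<integral>y. f y \<partial>\<mu> x) \<le> max B 0 * R"
proof -
  interpret finite_measure "\<mu> x" by (rule finite_measure_kernel) fact
  have "norm (\<integral>y. f y \<partial>\<mu> x) \<le> (\<integral>y. norm (f y) \<partial>\<mu> x)" by simp
  also have "\<dots> \<le> (\<integral>y. R \<partial>\<mu> x)"
    using integrable_kernel[OF assms(1,2)] assms(3) by (intro integral_mono) auto
  also have "\<dots> = measure (\<mu> x) X * R" by simp
  also have "\<dots> \<le> max B 0 * R" using measure_kernel_le[OF assms(1)] assms(4) by (rule mult_right_mono)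
  finally show ?thesis .
qed

text \<open>For the approximation \<open>h\<close> of \<open>g\<close> by a partition of unity,
  \<open>K h\<close> is a sum over the nodes \<open>c\<close> of \<open>c\<close> times a weighted
  sum of the three cell masses \<open>m x1 c\<close>, \<open>m x2 c\<close>, \<open>m x3 c\<close>.
  The inequality for real numbers applies in each cell, and summation over the cells leads back to
  \<open>pair\<close>.\<close>

lemma norm_weighted_integrals_le:
  fixes g :: "complex \<Rightarrow> complex"
  assumes pair: "\<And>u x y. \<lbrakk>continuous_on X u; \<And>z. z \<in> X \<Longrightarrow> \<bar>u z\<bar> \<le> (1::real); x \<in> X; y \<in> X\<rbrakk> \<Longrightarrow>
      (\<integral>z. u z \<partial>\<mu> x) - (\<integral>z. u z \<partial>\<mu> y) \<le> 2 * b"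
    and x: "x1 \<in> X" "x2 \<in> X" "x3 \<in> X"
    and w: "w1 + w2 + w3 = 0"
    and g: "continuous_on X g" "\<And>z. z \<in> X \<Longrightarrow> norm (g z) \<le> R"
  shows "norm (w1 * (\<integral>z. g z \<partial>\<mu> x1) + w2 * (\<integral>z. g z \<partial>\<mu> x2) + w3 * (\<integral>z. g z \<partial>\<mu> x3))
    \<le> R * b * (norm w1 + norm w2 + norm w3)"
proof -
  define W where "W = norm w1 + norm w2 + norm w3"
  define K where "K f = w1 * (\<integral>z. f z \<partial>\<mu> x1) + w2 * (\<integral>z. f z \<partial>\<mu> x2) + w3 * (\<integral>z. f z \<partial>\<mu> x3)"
    for f :: "complex \<Rightarrow> complex"
  obtain x0 where "x0 \<in> X" using nonempty by blast
  then have R: "R \<ge> 0" using g(2)[of x0] norm_ge_zero order_trans by blast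
  have approx: "norm (K g) \<le> R * b * W + \<epsilon> * (max B 0 * W)" if \<epsilon>: "\<epsilon> > 0" for \<epsilon>
  proof -
    obtain C \<phi> where C: "finite C" "C \<subseteq> g ` X" and cont: "\<And>c. continuous_on X (\<phi> c)"
      and pos: "\<And>c x. x \<in> X \<Longrightarrow> \<phi> c x \<ge> (0::real)"
      and one: "\<And>x. x \<in> X \<Longrightarrow> (\<Sum>c\<in>C. \<phi> c x) = 1"
      and close: "\<And>x. x \<in> X \<Longrightarrow> norm (g x - (\<Sum>c\<in>C. \<phi> c x *\<^sub>R c)) \<le> \<epsilon>"
      by (rule partition_of_unity_along[OF compact g(1) \<epsilon>]) blast
    define h where "h x = (\<Sum>c\<in>C. \<phi> c x *\<^sub>R c)" for x
    define m where "m x c = (\<integral>z. \<phi> c z \<partial>\<mu> x)" for x c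
    have cont_h: "continuous_on X h"
      unfolding h_def by (intro continuous_intros cont)
    have int_h: "(\<integral>z. h z \<partial>\<mu> x) = (\<Sum>c\<in>C. of_real (m x c) * c)" if "x \<in> X" for x
      using integrable_kernel[OF that cont]
      by (simp add: h_def m_def scaleR_conv_of_real)
    have pair_m: "(\<Sum>c\<in>C. \<bar>m x c - m y c\<bar>) \<le> 2 * b" if "x \<in> X" "y \<in> X" for x y
    proof -
      \<comment> \<open>Choosing in each cell the sign of the difference of masses turns the sum of
        absolute values into the difference of two averages of a single admissible function
        \<open>u\<close>.\<close>
      define s where "s c = sgn (m x c - m y c)" for c
      define u where "u z = (\<Sum>c\<in>C. s c * \<phi> c z)" for z
      have "(\<Sum>c\<in>C. \<bar>m x c - m y c\<bar>) = (\<Sum>c\<in>C. s c * (m x c - m y c))"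
        by (intro sum.cong) (auto simp: s_def abs_sgn mult.commute)
      also have "\<dots> = (\<integral>z. u z \<partial>\<mu> x) - (\<integral>z. u z \<partial>\<mu> y)"
        using integrable_kernel[OF that(1) cont] integrable_kernel[OF that(2) cont]
        by (simp add: u_def m_def sum_subtractf right_diff_distrib)
      also have "\<dots> \<le> 2 * b"
      proof (rule pair)
        show "continuous_on X u" unfolding u_def by (intro continuous_intros cont)
        show "\<bar>u z\<bar> \<le> 1" if "z \<in> X" for z
        proof -
          have "\<bar>u z\<bar> \<le> (\<Sum>c\<in>C. \<bar>s c * \<phi> c z\<bar>)" unfolding u_def by (rule sum_abs)
          also have "\<dots> \<le> (\<Sum>c\<in>C. \<phi> c z)"
            using pos[OF that] by (intro sum_mono) (auto simp: s_def abs_mult sgn_if)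
          finally show ?thesis using one[OF that] by simp
        qed
      qed (use that in auto)
      finally show ?thesis .
    qed
    have "2 * norm (K h) = 2 * norm (\<Sum>c\<in>C. c * (of_real (m x1 c) * w1 + of_real (m x2 c) * w2 + of_real (m x3 c) * w3))"
      unfolding K_def int_h[OF x(1)] int_h[OF x(2)] int_h[OF x(3)]
      by (simp add: sum_distrib_left sum.distrib[symmetric] algebra_simps)
    also have "\<dots> \<le> 2 * (\<Sum>c\<in>C. norm (c * (of_real (m x1 c) * w1 + of_real (m x2 c) * w2 + of_real (m x3 c) * w3)))"
      using norm_sum by (intro mult_left_mono) auto
    also have "\<dots> = (\<Sum>c\<in>C. norm c * (2 * norm (of_real (m x1 c) * w1 + of_real (m x2 c) * w2 + of_real (m x3 c) * w3)))"
      by (simp add: norm_mult sum_distrib_left mult_ac)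
    also have "\<dots> \<le> (\<Sum>c\<in>C. R * ((norm w1 + norm w2 - norm w3) * \<bar>m x1 c - m x2 c\<bar>
        + (norm w1 + norm w3 - norm w2) * \<bar>m x1 c - m x3 c\<bar>
        + (norm w2 + norm w3 - norm w1) * \<bar>m x2 c - m x3 c\<bar>))"
      using C(2) g(2) R by (intro sum_mono mult_mono norm_weighted_sum_le w) auto
    also have "\<dots> = R * ((norm w1 + norm w2 - norm w3) * (\<Sum>c\<in>C. \<bar>m x1 c - m x2 c\<bar>)
        + (norm w1 + norm w3 - norm w2) * (\<Sum>c\<in>C. \<bar>m x1 c - m x3 c\<bar>)
        + (norm w2 + norm w3 - norm w1) * (\<Sum>c\<in>C. \<bar>m x2 c - m x3 c\<bar>))"
      by (simp only: sum_distrib_left[symmetric] sum.distrib)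
    also have "\<dots> \<le> R * ((norm w1 + norm w2 - norm w3) * (2 * b)
        + (norm w1 + norm w3 - norm w2) * (2 * b) + (norm w2 + norm w3 - norm w1) * (2 * b))"
    proof -
      \<comment> \<open>Since the weights add up to 0, their moduli satisfy the triangle
        inequalities. This makes the three coefficients nonnegative, so the bound for each pair may
        be inserted.\<close>
      have tri: "norm a \<le> norm b' + norm c'" if "a + b' + c' = 0" for a b' c' :: complex
      proof -
        have "a = - (b' + c')" using that by (metis add.assoc eq_neg_iff_add_eq_0)
        then show ?thesis using norm_triangle_ineq[of b' c'] by (simp only: norm_minus_cancel)
      qed
      have "norm w3 \<le> norm w1 + norm w2" "norm w2 \<le> norm w1 + norm w3" "norm w1 \<le> norm w2 + norm w3"
        using tri[of w3 w1 w2] tri[of w2 w1 w3] tri[of w1 w2 w3] w by (simp_all add: ac_simps)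
      then have "0 \<le> norm w1 + norm w2 - norm w3" "0 \<le> norm w1 + norm w3 - norm w2"
        "0 \<le> norm w2 + norm w3 - norm w1" by linarith+
      then show ?thesis
        by (intro mult_left_mono[OF _ R] add_mono mult_left_mono[OF pair_m] x)
    qed
   also have "\<dots> = 2 * (R * b * W)" by (simp add: W_def algebra_simps)
    finally have 1: "norm (K h) \<le> R * b * W" by simp
    have diff: "(\<integral>z. g z \<partial>\<mu> x) = (\<integral>z. h z \<partial>\<mu> x) + (\<integral>z. g z - h z \<partial>\<mu> x)" if "x \<in> X" for x
      using integrable_kernel[OF that g(1)] integrable_kernel[OF that cont_h] by simp
    have small: "norm (w * (\<integral>z. g z - h z \<partial>\<mu> x)) \<le> \<epsilon> * max B 0 * norm w" if "x \<in> X" for x w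
    proof -
      have "norm (\<integral>z. g z - h z \<partial>\<mu> x) \<le> max B 0 * \<epsilon>"
        using close \<epsilon> by (intro norm_integral_kernel_le[OF that] continuous_intros g(1) cont_h)
          (auto simp: h_def)
      from mult_left_mono[OF this norm_ge_zero[of w]] show ?thesis by (simp add: norm_mult mult_ac)
    qed
    have K_g: "K g = K h + (w1 * (\<integral>z. g z - h z \<partial>\<mu> x1) + w2 * (\<integral>z. g z - h z \<partial>\<mu> x2)
        + w3 * (\<integral>z. g z - h z \<partial>\<mu> x3))"
      unfolding K_def diff[OF x(1)] diff[OF x(2)] diff[OF x(3)] by (simp only: ring_distribs add_ac)
    have "norm (K g) \<le> norm (K h) + (norm (w1 * (\<integral>z. g z - h z \<partial>\<mu> x1)) + norm (w2 * (\<integral>z. g z - h z \<partial>\<mu> x2))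
        + norm (w3 * (\<integral>z. g z - h z \<partial>\<mu> x3)))"
      unfolding K_g
      by (intro order_trans[OF norm_triangle_ineq add_left_mono] order_trans[OF norm_triangle_ineq add_right_mono]
          norm_triangle_ineq)
    also have "\<dots> \<le> R * b * W + (\<epsilon> * max B 0 * norm w1 + \<epsilon> * max B 0 * norm w2 + \<epsilon> * max B 0 * norm w3)"
      by (rule add_mono[OF 1 add_mono[OF add_mono[OF small[OF x(1)] small[OF x(2)]] small[OF x(3)]]])
    finally show ?thesis by (simp add: W_def algebra_simps)
  qed
  have "norm (K g) \<le> R * b * W"
  proof (rule field_le_epsilon)
    fix e :: real assume e: "e > 0"
    \<comment> \<open>The added 1 keeps the denominator positive when \<open>max B 0 * W\<close> is
      0.\<close>
    have D: "max B 0 * W + 1 > 0" by (simp add: W_def add_nonneg_pos)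
    have "norm (K g) \<le> R * b * W + e / (max B 0 * W + 1) * (max B 0 * W)"
      using e D by (intro approx) simp
    also have "e / (max B 0 * W + 1) * (max B 0 * W) \<le> e"
      using e D by (simp add: field_simps)
    finally show "norm (K g) \<le> R * b * W + e" by simp
  qed
  then show ?thesis by (simp add: K_def W_def)
qed

text \<open>A centre \<open>c\<close> is a common point of the discs of radius \<open>R * b\<close>
  around all averages. Helly reduces this to three discs, and duality reduces three discs to the
  weighted inequality.\<close>

lemma integrals_in_cball:
  fixes g :: "complex \<Rightarrow> complex"
  assumes pair: "\<And>u x y. \<lbrakk>continuous_on X u; \<And>z. z \<in> X \<Longrightarrow> \<bar>u z\<bar> \<le> (1::real); x \<in> X; y \<in> X\<rbrakk> \<Longrightarrow>
      (\<integral>z. u z \<partial>\<mu> x) - (\<integral>z. u z \<partial>\<mu> y) \<le> 2 * b"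
    and g: "continuous_on X g" "\<And>z. z \<in> X \<Longrightarrow> norm (g z) \<le> R"
  shows "\<exists>c. \<forall>x\<in>X. norm ((\<integral>z. g z \<partial>\<mu> x) - c) \<le> R * b"
proof (rule common_point_cballs, rule common_point_three_cballs)
  obtain x0 where x0: "x0 \<in> X" using nonempty by blast
  have "R \<ge> 0" using g(2)[OF x0] norm_ge_zero order_trans by blast
  moreover have "b \<ge> 0" using pair[of "\<lambda>_. 0" x0 x0] x0 by simp
  ultimately show "R * b \<ge> 0" by simp
  fix x y z a1 a2 a3
  assume x: "x \<in> X" "y \<in> X" "z \<in> X" and a: "a1 + a2 + a3 = (0::complex)"
  define P where "P x = (\<integral>z. g z \<partial>\<mu> x)" for x
  \<comment> \<open>The real inner product of the plane turns the dual vectors \<open>a1\<close>,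
    \<open>a2\<close>, \<open>a3\<close> into complex weights, namely their conjugates.\<close>
  have inner: "inner a c = Re (cnj a * c)" for a c by (simp add: inner_complex_def)
  have "cnj a1 + cnj a2 + cnj a3 = 0" using arg_cong[OF a, of cnj] by simp
  then have "norm (cnj a1 * P x + cnj a2 * P y + cnj a3 * P z) \<le> R * b * (norm a1 + norm a2 + norm a3)"
    using norm_weighted_integrals_le[of b x y z "cnj a1" "cnj a2" "cnj a3" g R] pair x g
    by (simp add: P_def)
  moreover have "\<bar>inner a1 (P x) + inner a2 (P y) + inner a3 (P z)\<bar>
      \<le> norm (cnj a1 * P x + cnj a2 * P y + cnj a3 * P z)"
    using abs_Re_le_cmod[of "cnj a1 * P x + cnj a2 * P y + cnj a3 * P z"] by (simp add: inner)
  ultimately show "\<bar>inner a1 (\<integral>z. g z \<partial>\<mu> x) + inner a2 (\<integral>w. g w \<partial>\<mu> y) + inner a3 (\<integral>w. g w \<partial>\<mu> z)\<bar>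
      \<le> R * b * (norm a1 + norm a2 + norm a3)"
    unfolding P_def by linarith
qed

end

section \<open>Norms modulo constants\<close>

lemma quotient_norm_le:
  assumes "X \<noteq> {}" "\<And>x. x \<in> X \<Longrightarrow> norm (g x - c) \<le> r"
  shows "quotient_norm X g \<le> r"
proof (cases "bdd_below (range (\<lambda>c. SUP x\<in>X. norm (g x - c)))")
  case True
  then have "quotient_norm X g \<le> (SUP x\<in>X. norm (g x - c))"
    unfolding quotient_norm_def by (intro cINF_lower) auto
  also have "\<dots> \<le> r" using assms by (intro cSUP_least)
  finally show ?thesis .
next
  case False
  obtain x0 where x0: "x0 \<in> X" using assms(1) by blast
  \<comment> \<open>This case is contradictory: \<open>g\<close> stays within \<open>r\<close> of
    \<open>c\<close>, so every supremum is over a nonempty bounded set of norms, and 0 is a lower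
    bound of them all.\<close>
  have "0 \<le> (SUP x\<in>X. norm (g x - d))" for d
  proof -
    have "norm (g x - d) \<le> r + norm (c - d)" if "x \<in> X" for x
      using norm_triangle_ineq[of "g x - c" "c - d"] assms(2)[OF that] by simp
    then have "bdd_above ((\<lambda>x. norm (g x - d)) ` X)" by (auto simp: bdd_above_def)
    then show ?thesis using cSUP_upper[OF x0] norm_ge_zero order_trans by blast
  qed
  then show ?thesis using False by (auto simp: bdd_below_def)
qed

text \<open>The strict inequality yields a constant without any attainment of the infimum;
  boundedness makes the supremum an actual upper bound.\<close>

lemma quotient_norm_less:
  assumes "quotient_norm X g < r" "bounded (g ` X)"
  shows "\<exists>c. \<forall>x\<in>X. norm (g x - c) \<le> r"
proof -
  have "(INF c. SUP x\<in>X. norm (g x - c)) < r" using assms(1) by (simp add: quotient_norm_def)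
  then obtain c where c: "(SUP x\<in>X. norm (g x - c)) < r"
    using cINF_greatest[of UNIV r "\<lambda>c. SUP x\<in>X. norm (g x - c)"] by (auto simp: not_le[symmetric])
  have "bounded ((\<lambda>x. g x - c) ` X)"
    by (rule bounded_minus_comp[OF assms(2)]) (auto simp: bounded_iff)
  then have "bdd_above ((\<lambda>x. norm (g x - c)) ` X)"
    by (auto simp: bounded_iff bdd_above_def)
  then have "norm (g x - c) \<le> r" if "x \<in> X" for x
    using c cSUP_upper[OF that] by fastforce
  then show ?thesis by blast
qed

section \<open>Transfer of bounds between real and complex functions\<close>

context bounded_kernel
begin

text \<open>The counterpart of \<open>neumann_poincare\<close> for an abstract kernel.\<close>

definition average :: "(complex \<Rightarrow> 'a::{banach,second_countable_topology}) \<Rightarrow> complex \<Rightarrow> 'a" where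
  "average f x = (\<integral>y. f y \<partial>\<mu> x)"

lemma bounded_average:
  fixes f :: "complex \<Rightarrow> 'a::{banach,second_countable_topology}"
  assumes "continuous_on X f"
  shows "bounded (average f ` X)"
proof -
  obtain R where "R \<ge> 0" "\<And>x. x \<in> X \<Longrightarrow> norm (f x) \<le> R" using bounded_on[OF assms] by metis
  then show ?thesis
    using norm_integral_kernel_le[OF _ assms] by (auto simp: bounded_iff average_def)
qed

lemma quotient_norm_continuous_less:
  fixes f :: "complex \<Rightarrow> 'a::real_normed_vector"
  assumes "quotient_norm X f < r" "continuous_on X f"
  shows "\<exists>c. \<forall>x\<in>X. norm (f x - c) \<le> r"
  using assms compact_imp_bounded[OF compact_continuous_image[OF assms(2) compact]]
  by (intro quotient_norm_less)

text \<open>A real function keeps its admissible constants when regarded as complex, and replacing a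
  complex centre by its real part brings it no farther from the real averages.\<close>

lemma real_bound_if_complex_bound:
  fixes f :: "complex \<Rightarrow> real"
  assumes bound: "\<And>F :: complex \<Rightarrow> complex. continuous_on X F \<Longrightarrow> quotient_norm X F \<le> 1 \<Longrightarrow>
      quotient_norm X (average F) \<le> b"
    and f: "continuous_on X f" "quotient_norm X f \<le> 1"
  shows "quotient_norm X (average f) \<le> b"
proof (rule field_le_epsilon)
  fix e :: real assume e: "e > 0"
  define F where "F = (\<lambda>x. complex_of_real (f x))"
  have cont: "continuous_on X F" unfolding F_def by (intro continuous_intros f)
  have "quotient_norm X F \<le> 1"
  proof (rule field_le_epsilon)
    fix d :: real assume "d > 0"
    then have "quotient_norm X f < 1 + d" using f(2) by linarith
    from quotient_norm_continuous_less[OF this f(1)]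
    obtain c where c: "\<And>x. x \<in> X \<Longrightarrow> norm (f x - c) \<le> 1 + d" by blast
    have "norm (F x - of_real c) = norm (f x - c)" for x
      unfolding F_def of_real_diff[symmetric] norm_of_real by simp
    then show "quotient_norm X F \<le> 1 + d"
      using c by (intro quotient_norm_le[OF nonempty, of _ "of_real c"]) simp
  qed
  then have "quotient_norm X (average F) \<le> b" by (rule bound[OF cont])
  then have "quotient_norm X (average F) < b + e" using e by linarith
  from quotient_norm_less[OF this bounded_average[OF cont]]
  obtain c where c: "\<And>x. x \<in> X \<Longrightarrow> norm (average F x - c) \<le> b + e" by blast
  show "quotient_norm X (average f) \<le> b + e"
  proof (rule quotient_norm_le[OF nonempty])
    fix x assume x: "x \<in> X"
    have "average f x - Re c = Re (average F x - c)"
      by (simp add: average_def F_def)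
    then have "norm (average f x - Re c) \<le> norm (average F x - c)"
      using abs_Re_le_cmod[of "average F x - c"] by simp
    then show "norm (average f x - Re c) \<le> b + e" using c[OF x] by linarith
  qed
qed

text \<open>The bound \<open>b\<close> on real functions controls their oscillation by
  \<open>2 * b\<close>, which is the hypothesis of \<open>integrals_in_cball\<close>. Applied to
  \<open>F - c\<close> for a nearly optimal \<open>c\<close>, that lemma gives a disc; equality of
  the masses carries the disc over to \<open>F\<close> itself.\<close>

lemma complex_bound_if_real_bound:
  fixes F :: "complex \<Rightarrow> complex"
  assumes bound: "\<And>f :: complex \<Rightarrow> real. continuous_on X f \<Longrightarrow> quotient_norm X f \<le> 1 \<Longrightarrow>
      quotient_norm X (average f) \<le> b"
    and F: "continuous_on X F" "quotient_norm X F \<le> 1"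
  shows "quotient_norm X (average F) \<le> b"
proof -
  have osc: "average f x - average f y \<le> 2 * b"
    if f: "continuous_on X f" "quotient_norm X f \<le> 1" and xy: "x \<in> X" "y \<in> X" for f :: "complex \<Rightarrow> real" and x y
  proof (rule field_le_epsilon)
    fix e :: real assume "e > 0"
    then have "quotient_norm X (average f) < b + e / 2" using bound[OF f] by linarith
    from quotient_norm_less[OF this bounded_average[OF f(1)]]
    obtain c where "\<And>x. x \<in> X \<Longrightarrow> norm (average f x - c) \<le> b + e / 2" by blast
    from this[OF xy(1)] this[OF xy(2)] show "average f x - average f y \<le> 2 * b + e" by simp
  qed
  have pair: "(\<integral>z. u z \<partial>\<mu> x) - (\<integral>z. u z \<partial>\<mu> y) \<le> 2 * b"
    if "continuous_on X u" "\<And>z. z \<in> X \<Longrightarrow> \<bar>u z\<bar> \<le> 1" "x \<in> X" "y \<in> X" for u :: "complex \<Rightarrow> real" and x y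
    using osc[of u x y] that quotient_norm_le[OF nonempty, of u 0 1] by (simp add: average_def)
  \<comment> \<open>A constant function has admissible quotient norm whatever its size, but its
    averages differ by \<open>d * t\<close>; the value of \<open>t\<close> makes this
    \<open>2 * b + 1\<close>.\<close>
  have mass_le: "measure (\<mu> x) X \<le> measure (\<mu> y) X" if xy: "x \<in> X" "y \<in> X" for x y
  proof (rule ccontr)
    define d where "d = measure (\<mu> x) X - measure (\<mu> y) X"
    assume "\<not> ?thesis"
    then have d: "d > 0" by (simp add: d_def)
    define t where "t = (2 * b + 1) / d"
    have "average (\<lambda>_. t) x - average (\<lambda>_. t) y \<le> 2 * b"
      using xy by (intro osc quotient_norm_le[OF nonempty, of _ t]) auto
    then have "d * t \<le> 2 * b" by (simp add: average_def d_def algebra_simps)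
    then show False using d by (simp add: t_def)
  qed
  obtain x0 where x0: "x0 \<in> X" using nonempty by blast
  define m where "m = measure (\<mu> x0) X"
  have m: "measure (\<mu> x) X = m" if "x \<in> X" for x
    unfolding m_def using mass_le[OF that x0] mass_le[OF x0 that] by simp
  have b: "b \<ge> 0" using pair[of "\<lambda>_. 0" x0 x0] x0 by simp
  show ?thesis
  proof (rule field_le_epsilon)
    fix e :: real assume e: "e > 0"
    \<comment> \<open>The slack \<open>d\<close> pays for an only approximately optimal
      \<open>c\<close> and enlarges the radius by \<open>d * b\<close>; dividing by
      \<open>b + 1\<close> covers the case where \<open>b\<close> is 0.\<close>
    define d where "d = e / (b + 1)"
    have d: "d > 0" "d * b \<le> e" using e b by (auto simp: d_def field_simps)
    have "quotient_norm X F < 1 + d" using d(1) F(2) by linarith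
    from quotient_norm_continuous_less[OF this F(1)]
    obtain c where c: "\<And>x. x \<in> X \<Longrightarrow> norm (F x - c) \<le> 1 + d" by blast
    have cont: "continuous_on X (\<lambda>x. F x - c)" by (intro continuous_intros F)
    obtain p where p: "\<And>x. x \<in> X \<Longrightarrow> norm ((\<integral>z. F z - c \<partial>\<mu> x) - p) \<le> (1 + d) * b"
      using integrals_in_cball[OF pair cont c] by blast
    show "quotient_norm X (average F) \<le> b + e"
    proof (rule quotient_norm_le[OF nonempty])
      fix x assume x: "x \<in> X"
      \<comment> \<open>All masses being \<open>m\<close>, the shift by \<open>c\<close> moves every
        average by the same amount.\<close>
      have "(\<integral>z. F z - c \<partial>\<mu> x) = average F x - m *\<^sub>R c"
        using integrable_kernel[OF x F(1)] integrable_kernel[OF x, of "\<lambda>_. c"] m[OF x]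
        by (simp add: average_def)
      then have "norm (average F x - (p + m *\<^sub>R c)) \<le> (1 + d) * b"
        using p[OF x] by (simp add: diff_diff_eq add.commute)
      also have "\<dots> \<le> b + e" using d by (simp add: algebra_simps)
      finally show "norm (average F x - (p + m *\<^sub>R c)) \<le> b + e" .
    qed
  qed
qed

text \<open>
  No boundedness is required here: the supremum of a set of reals is by definition the least upper
  bound, also in the degenerate case, and so depends on the set of upper bounds only.
\<close>

lemma Sup_quotient_norm_average:
  "(SUP f\<in>{f :: complex \<Rightarrow> real. continuous_on X f \<and> quotient_norm X f \<le> 1}. quotient_norm X (average f))
   = (SUP f\<in>{f :: complex \<Rightarrow> complex. continuous_on X f \<and> quotient_norm X f \<le> 1}. quotient_norm X (average f))"
proof -
  have "(\<forall>f::complex \<Rightarrow> real. continuous_on X f \<and> quotient_norm X f \<le> 1 \<longrightarrow> quotient_norm X (average f) \<le> b)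
    \<longleftrightarrow> (\<forall>f::complex \<Rightarrow> complex. continuous_on X f \<and> quotient_norm X f \<le> 1 \<longrightarrow> quotient_norm X (average f) \<le> b)"
    for b
    using real_bound_if_complex_bound[of b] complex_bound_if_real_bound[of b] by blast
  then show ?thesis unfolding Sup_real_def by simp
qed

end

section \<open>Lebesgue--Stieltjes measures and right derivatives\<close>

text \<open>\<open>density\<close> is built by \<open>measure_of\<close>, so its value on
  \<open>A\<close> is either the integral over \<open>A\<close> or 0. Stated for arbitrary
  \<open>f\<close>, this applies to \<open>np_density\<close> without a proof of measurability; the
  next two lemmas serve the same end.\<close>

lemma emeasure_density_le: "emeasure (density M f) A \<le> (\<integral>\<^sup>+x. f x \<partial>M)"
proof -
  have "(\<integral>\<^sup>+x. f x * indicator A x \<partial>M) \<le> (\<integral>\<^sup>+x. f x \<partial>M)"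
    by (intro nn_integral_mono) (auto split: split_indicator)
  then show ?thesis unfolding density_def emeasure_measure_of_conv by auto
qed

text \<open>The left side is a supremum over simple functions below \<open>f\<close>; each of them
  is measurable and pulls back to a function below \<open>f\<close> composed with
  \<open>T\<close>.\<close>

lemma nn_integral_distr_le:
  assumes "T \<in> measurable M N"
  shows "(\<integral>\<^sup>+x. f x \<partial>distr M N T) \<le> (\<integral>\<^sup>+x. f (T x) \<partial>M)"
  unfolding nn_integral_def[of "distr M N T"]
proof (rule SUP_least)
  fix g assume "g \<in> {g. simple_function (distr M N T) g \<and> g \<le> f}"
  then have g: "simple_function (distr M N T) g" "g \<le> f" by auto
  have "integral\<^sup>S (distr M N T) g = (\<integral>\<^sup>+x. g x \<partial>distr M N T)"
    using g(1) by (simp add: nn_integral_eq_simple_integral)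
  also have "\<dots> = (\<integral>\<^sup>+x. g (T x) \<partial>M)"
    by (rule nn_integral_distr[OF assms borel_measurable_simple_function[OF g(1)]])
  also have "\<dots> \<le> (\<integral>\<^sup>+x. f (T x) \<partial>M)"
    using g(2) by (intro nn_integral_mono) (auto simp: le_fun_def)
  finally show "integral\<^sup>S (distr M N T) g \<le> (\<integral>\<^sup>+x. f (T x) \<partial>M)" .
qed

text \<open>Again the equation for simple functions below \<open>f\<close> gives one inequality for
  \<open>f\<close> itself.\<close>

lemma nn_integral_density_le:
  assumes "g \<in> borel_measurable M"
  shows "(\<integral>\<^sup>+x. f x \<partial>density M g) \<le> (\<integral>\<^sup>+x. g x * f x \<partial>M)"
  unfolding nn_integral_def[of "density M g"]
proof (rule SUP_least)
  fix s assume "s \<in> {s. simple_function (density M g) s \<and> s \<le> f}"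
  then have s: "simple_function (density M g) s" "s \<le> f" by auto
  have "integral\<^sup>S (density M g) s = (\<integral>\<^sup>+x. s x \<partial>density M g)"
    using s(1) by (simp add: nn_integral_eq_simple_integral)
  also have "\<dots> = (\<integral>\<^sup>+x. g x * s x \<partial>M)"
    using borel_measurable_simple_function[OF s(1)] by (intro nn_integral_density assms) simp
  also have "\<dots> \<le> (\<integral>\<^sup>+x. g x * f x \<partial>M)"
    using s(2) by (intro nn_integral_mono mult_left_mono) (auto simp: le_fun_def)
  finally show "integral\<^sup>S (density M g) s \<le> (\<integral>\<^sup>+x. g x * f x \<partial>M)" .
qed

section \<open>Comparison of Stieltjes measures\<close>

lemma measure_eqI_Ioc:
  fixes M N :: "real measure"
  assumes sets: "sets M = sets borel" "sets N = sets borel"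
    and eq: "\<And>a b. a \<le> b \<Longrightarrow> emeasure M {a<..b} = emeasure N {a<..b}"
    and finite: "\<And>a b. a \<le> b \<Longrightarrow> emeasure M {a<..b} \<noteq> \<infinity>"
  shows "M = N"
proof (rule measure_eqI_generator_eq[where \<Omega> = UNIV and E = "range (\<lambda>(a, b). {a<..b::real})"
      and A = "\<lambda>n. {- real n<..real n}"])
  show "Int_stable (range (\<lambda>(a, b). {a<..b::real}))"
    by (auto simp: Int_stable_def Int_greaterThanAtMost)
  show "emeasure M X = emeasure N X" if X: "X \<in> range (\<lambda>(a, b). {a<..b})" for X
  proof -
    obtain a b where "X = {a<..b}" using X by auto
    then show ?thesis using eq[of a b] by (cases "a \<le> b") auto
  qed
  show "sets M = sigma_sets UNIV (range (\<lambda>(a, b). {a<..b::real}))"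
    "sets N = sigma_sets UNIV (range (\<lambda>(a, b). {a<..b::real}))"
    unfolding sets by (subst borel_sigma_sets_Ioc; simp)+
  show "(\<Union>n. {- real n<..real n}) = UNIV"
  proof (intro equalityI subsetI UNIV_I)
    fix x :: real
    obtain n where "\<bar>x\<bar> < real n" using reals_Archimedean2 by blast
    then have "x \<in> {- real n<..real n}" by auto
    then show "x \<in> (\<Union>n. {- real n<..real n})" by blast
  qed
  show "emeasure M {- real n<..real n} \<noteq> \<infinity>" for n by (rule finite) simp
qed auto

text \<open>\<^term>\<open>interval_measure (\<lambda>t. G t - F t)\<close> is the difference of the two measures.\<close>

lemma interval_measure_mono:
  fixes F G :: "real \<Rightarrow> real"
  assumes F: "\<And>x y. x \<le> y \<Longrightarrow> F x \<le> F y" "\<And>a. continuous (at_right a) F"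
    and G: "\<And>a. continuous (at_right a) G"
    and FG: "\<And>x y. x \<le> y \<Longrightarrow> F y - F x \<le> G y - G x"
  shows "interval_measure F \<le> interval_measure G"
proof -
  define H where "H t = G t - F t" for t
  have G_mono: "G x \<le> G y" if "x \<le> y" for x y using F(1)[OF that] FG[OF that] by linarith
  have H: "H x \<le> H y" if "x \<le> y" for x y
    using FG[OF that] by (simp add: H_def)
  have H_cont: "continuous (at_right a) H" for a
    unfolding H_def by (intro continuous_intros F G)
  define N where "N = measure_of UNIV (sets borel)
    (\<lambda>A. emeasure (interval_measure F) A + emeasure (interval_measure H) A)"
  have sets_N [simp]: "sets N = sets borel"
    using sets.sigma_sets_eq[of "borel :: real measure"] by (simp add: N_def)
  have N: "emeasure N A = emeasure (interval_measure F) A + emeasure (interval_measure H) A"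
    if "A \<in> sets borel" for A
    unfolding N_def
  proof (rule emeasure_measure_of_sigma)
    show "sigma_algebra UNIV (sets (borel :: real measure))"
      using sets.sigma_algebra_axioms[of "borel :: real measure"] by simp
    show "positive (sets borel) (\<lambda>A. emeasure (interval_measure F) A + emeasure (interval_measure H) A)"
      by (simp add: positive_def)
    show "countably_additive (sets borel) (\<lambda>A. emeasure (interval_measure F) A + emeasure (interval_measure H) A)"
      by (intro countably_additiveI) (simp add: suminf_add[symmetric] suminf_emeasure)
  qed fact
  have "N = interval_measure G"
  proof (rule measure_eqI_Ioc)
    fix a b :: real assume ab: "a \<le> b"
    have "emeasure N {a<..b} = ennreal (F b - F a) + ennreal (H b - H a)"
      by (simp add: N emeasure_interval_measure_Ioc[OF ab] F H H_cont)
    also have "\<dots> = ennreal (G b - G a)"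
      using F(1)[OF ab] H[OF ab] by (subst ennreal_plus[symmetric]) (auto simp: H_def)
    also have "\<dots> = emeasure (interval_measure G) {a<..b}"
      using G G_mono by (simp add: emeasure_interval_measure_Ioc[OF ab])
    finally show eq: "emeasure N {a<..b} = emeasure (interval_measure G) {a<..b}" .
    show "emeasure N {a<..b} \<noteq> \<infinity>"
      unfolding eq using G G_mono by (simp add: emeasure_interval_measure_Ioc[OF ab])
  qed simp_all
  then have "emeasure (interval_measure F) A \<le> emeasure (interval_measure G) A" for A
    using N[of A] by (cases "A \<in> sets borel") (auto simp: emeasure_notin_sets)
  then show ?thesis by (auto simp: le_measure_iff le_fun_def)
qed

text \<open>The clamped parameter in \<open>lip\<close> makes \<open>F\<close> constant outside the
  interval from \<open>a\<close> to \<open>b\<close>. Thus \<open>F\<close> grows no faster than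
  \<open>G\<close>, whose Stieltjes measure is \<open>L\<close> times Lebesgue measure on
  \<open>{a<..b}\<close>.\<close>

lemma nn_integral_interval_measure_le:
  fixes F :: "real \<Rightarrow> real"
  assumes mono: "\<And>x y. x \<le> y \<Longrightarrow> F x \<le> F y" and L: "L \<ge> 0" and ab: "a \<le> b"
    and lip: "\<And>x y. x \<le> y \<Longrightarrow> F y - F x \<le> L * (max a (min y b) - max a (min x b))"
  shows "(\<integral>\<^sup>+t. f t \<partial>interval_measure F) \<le> (\<integral>\<^sup>+t. ennreal L * indicator {a<..b} t * f t \<partial>lborel)"
proof -
  define G where "G t = L * max a (min t b)" for t
  have G: "continuous (at_right t) G" for t
    unfolding G_def by (intro continuous_intros)
  have G_mono: "G x \<le> G y" if "x \<le> y" for x y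
    unfolding G_def using that L by (intro mult_left_mono) auto
  have F: "continuous (at_right t) F" for t
  proof -
    have "((\<lambda>x. L * (x - t)) \<longlongrightarrow> L * (t - t)) (at_right t)" by (intro tendsto_intros)
    then have lim: "((\<lambda>x. L * (x - t)) \<longlongrightarrow> 0) (at_right t)" by simp
    have "((\<lambda>x. F x - F t) \<longlongrightarrow> 0) (at_right t)"
    proof (rule tendsto_sandwich[OF _ _ tendsto_const lim])
      have "F x - F t \<le> L * (x - t)" if "t < x" for x
      proof -
        have "F x - F t \<le> L * (max a (min x b) - max a (min t b))" using lip[of t x] that by simp
        also have "\<dots> \<le> L * (x - t)" using that L by (intro mult_left_mono) (auto simp: max_def min_def)
        finally show ?thesis .
      qed
      then show "\<forall>\<^sub>F x in at_right t. F x - F t \<le> L * (x - t)"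
        by (auto simp: eventually_at_filter)
      show "\<forall>\<^sub>F x in at_right t. 0 \<le> F x - F t"
        using mono by (auto simp: eventually_at_filter)
    qed
    then show ?thesis
      using Lim_null[of F "F t" "at_right t"] by (simp add: continuous_within)
  qed
  have le: "interval_measure F \<le> interval_measure G"
    using lip by (intro interval_measure_mono mono F G) (auto simp: G_def algebra_simps)
  have "interval_measure G = density lborel (\<lambda>t. ennreal L * indicator {a<..b} t)"
  proof (rule measure_eqI_Ioc)
    fix c d :: real assume cd: "c \<le> d"
    have "emeasure (density lborel (\<lambda>t. ennreal L * indicator {a<..b} t)) {c<..d}
        = (\<integral>\<^sup>+t. ennreal L * indicator ({a<..b} \<inter> {c<..d}) t \<partial>lborel)"
      by (subst emeasure_density) (auto intro!: nn_integral_cong split: split_indicator)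
    also have "\<dots> = ennreal L * emeasure lborel ({a<..b} \<inter> {c<..d})"
      by (simp add: nn_integral_cmult_indicator)
    also have "{a<..b} \<inter> {c<..d} = {max a c<..min b d}" by auto
    also have "ennreal L * emeasure lborel {max a c<..min b d} = ennreal (G d - G c)"
    proof (cases "max a c \<le> min b d")
      case True
      then have "max a (min d b) - max a (min c b) = min b d - max a c" using ab cd by linarith
      then show ?thesis
        using True L by (simp add: G_def ennreal_mult[symmetric] right_diff_distrib[symmetric])
    next
      case False
      then have "max a (min d b) = max a (min c b)" using ab cd by linarith
      then show ?thesis using False by (simp add: G_def)
    qed
    also have "\<dots> = emeasure (interval_measure G) {c<..d}"
      using G G_mono by (simp add: emeasure_interval_measure_Ioc[OF cd])
    finally show "emeasure (interval_measure G) {c<..d}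
      = emeasure (density lborel (\<lambda>t. ennreal L * indicator {a<..b} t)) {c<..d}" ..
    show "emeasure (interval_measure G) {c<..d} \<noteq> \<infinity>"
      using G G_mono by (simp add: emeasure_interval_measure_Ioc[OF cd])
  qed simp_all
  then have "(\<integral>\<^sup>+t. f t \<partial>interval_measure F)
      \<le> (\<integral>\<^sup>+t. f t \<partial>density lborel (\<lambda>t. ennreal L * indicator {a<..b} t))"
    using nn_integral_mono_measure[OF _ le, of f] by simp
  also have "\<dots> \<le> (\<integral>\<^sup>+t. ennreal L * indicator {a<..b} t * f t \<partial>lborel)"
    by (rule nn_integral_density_le) measurable
  finally show ?thesis .
qed

section \<open>Increments of monotone functions\<close>

text \<open>Integrating \<open>A (t + h)\<close> amounts to integrating \<open>A\<close> over the
  shifted interval, which exceeds the original one only by a piece of length \<open>h\<close> at the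
  right end. The function \<open>B\<close> is shifted by \<open>m\<close> to be nonnegative, and
  finiteness of its integral allows the cancellation at the end.\<close>

lemma nn_integral_increment_le:
  fixes A :: "real \<Rightarrow> real"
  assumes mono: "mono A" and bounds: "\<And>t. m \<le> A t" "\<And>t. A t \<le> M"
    and h: "h > 0" and ab: "a \<le> b"
  shows "(\<integral>\<^sup>+t. ennreal (A (t + h) - A t) * indicator {a..b} t \<partial>lborel) \<le> ennreal (h * (M - m))"
proof -
  define B where "B t = ennreal (A t - m)" for t
  have [measurable]: "A \<in> borel_measurable borel" using mono by (rule borel_measurable_mono)
  have [measurable]: "B \<in> borel_measurable borel" unfolding B_def by measurable
  have B: "B t \<le> ennreal (M - m)" for t unfolding B_def using bounds by (intro ennreal_leI) simp
  let ?I = "\<integral>\<^sup>+t. B t * indicator {a..b} t \<partial>lborel"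
  let ?D = "\<integral>\<^sup>+t. ennreal (A (t + h) - A t) * indicator {a..b} t \<partial>lborel"
  have "?I \<le> (\<integral>\<^sup>+t. ennreal (M - m) * indicator {a..b} t \<partial>lborel)"
    using B by (intro nn_integral_mono mult_right_mono) auto
  also have "\<dots> < \<infinity>" using ab by (simp add: nn_integral_cmult_indicator ennreal_mult_less_top)
  finally have fin: "?I \<noteq> \<infinity>" by simp
  have "?I + ?D = (\<integral>\<^sup>+t. B t * indicator {a..b} t + ennreal (A (t + h) - A t) * indicator {a..b} t \<partial>lborel)"
    by (rule nn_integral_add[symmetric]) auto
  also have "\<dots> = (\<integral>\<^sup>+t. B (t + h) * indicator {a..b} t \<partial>lborel)"
  proof (intro nn_integral_cong)
    fix t
    have "B t + ennreal (A (t + h) - A t) = B (t + h)"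
      unfolding B_def using bounds monoD[OF mono, of t "t + h"] h by (subst ennreal_plus[symmetric]) auto
    then show "B t * indicator {a..b} t + ennreal (A (t + h) - A t) * indicator {a..b} t
      = B (t + h) * indicator {a..b} t" by (simp add: distrib_right[symmetric])
  qed
  also have "\<dots> = (\<integral>\<^sup>+t. B t * indicator {a + h..b + h} t \<partial>lborel)"
    by (subst nn_integral_real_affine[where c = 1 and t = h and f = "\<lambda>t. B t * indicator {a + h..b + h} t"])
      (auto intro!: nn_integral_cong simp: add.commute split: split_indicator)
  also have "\<dots> \<le> (\<integral>\<^sup>+t. B t * indicator {a..b} t + ennreal (M - m) * indicator {b..b + h} t \<partial>lborel)"
    using B h by (intro nn_integral_mono) (auto split: split_indicator)
  also have "\<dots> = ?I + (\<integral>\<^sup>+t. ennreal (M - m) * indicator {b..b + h} t \<partial>lborel)"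
    by (rule nn_integral_add) auto
  also have "(\<integral>\<^sup>+t. ennreal (M - m) * indicator {b..b + h} t \<partial>lborel) = ennreal (h * (M - m))"
    using h bounds[of a] by (simp add: nn_integral_cmult_indicator ennreal_mult[symmetric] mult.commute)
  finally show ?thesis using fin by (simp add: ennreal_add_left_cancel_le)
qed

text \<open>Fatou's lemma, applied to the difference quotients with step \<open>1 / Suc n\<close>.\<close>

lemma right_derivative_dominated:
  fixes A D :: "real \<Rightarrow> real"
  assumes mono: "mono_on {a<..<b} A" and bounds: "\<And>t. a < t \<Longrightarrow> t < b \<Longrightarrow> m \<le> A t \<and> A t \<le> M"
    and mM: "m \<le> M" and ab: "a \<le> b"
    and deriv: "\<And>t. a < t \<Longrightarrow> t < b \<Longrightarrow> (A has_real_derivative D t) (at_right t)"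
  obtains G where "G \<in> borel_measurable lborel" "(\<integral>\<^sup>+t. G t \<partial>lborel) \<le> ennreal (M - m)"
    "\<And>t. a < t \<Longrightarrow> t < b \<Longrightarrow> ennreal (D t) \<le> G t"
proof -
  \<comment> \<open>Extension by the two bounds keeps the function monotone on the whole line, so
    that \<open>t + h n\<close> may leave the interval.\<close>
  define E where "E t = (if t \<le> a then m else if b \<le> t then M else A t)" for t
  have "mono E"
    using bounds mM ab by (auto simp: mono_def E_def intro: mono_onD[OF mono])
  then have [measurable]: "E \<in> borel_measurable borel" by (rule borel_measurable_mono)
  have E: "m \<le> E t" "E t \<le> M" for t using bounds mM by (auto simp: E_def)
  define h where "h n = 1 / real (Suc n)" for n
  have h: "h n > 0" for n by (simp add: h_def)
  have h_lim: "h \<longlonglongrightarrow> 0" unfolding h_def by (rule LIMSEQ_Suc[OF lim_1_over_n])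
  define g where "g n t = ennreal ((E (t + h n) - E t) / h n) * indicator {a..b} t" for n t
  have [measurable]: "g n \<in> borel_measurable lborel" for n unfolding g_def by measurable
  define G where "G t = liminf (\<lambda>n. g n t)" for t
  have g: "(\<integral>\<^sup>+t. g n t \<partial>lborel) \<le> ennreal (M - m)" for n
  proof -
    have "(\<integral>\<^sup>+t. g n t \<partial>lborel)
        = (\<integral>\<^sup>+t. ennreal (1 / h n) * (ennreal (E (t + h n) - E t) * indicator {a..b} t) \<partial>lborel)"
      using h[of n] monoD[OF \<open>mono E\<close>]
      by (intro nn_integral_cong) (auto simp: g_def ennreal_mult[symmetric] split: split_indicator)
    also have "\<dots> = ennreal (1 / h n) * (\<integral>\<^sup>+t. ennreal (E (t + h n) - E t) * indicator {a..b} t \<partial>lborel)"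
      by (rule nn_integral_cmult) measurable
    also have "\<dots> \<le> ennreal (1 / h n) * ennreal (h n * (M - m))"
      by (intro mult_left_mono nn_integral_increment_le[OF \<open>mono E\<close> E h ab]) simp
    also have "\<dots> = ennreal (M - m)"
      using h[of n] mM by (simp add: ennreal_mult[symmetric])
    finally show ?thesis .
  qed
  show thesis
  proof
    show "G \<in> borel_measurable lborel" unfolding G_def by measurable
    have "(\<integral>\<^sup>+t. G t \<partial>lborel) \<le> liminf (\<lambda>n. \<integral>\<^sup>+t. g n t \<partial>lborel)"
      unfolding G_def by (rule nn_integral_liminf) simp
    also have "\<dots> \<le> liminf (\<lambda>n. ennreal (M - m))" using g by (intro Liminf_mono) simp
    also have "\<dots> = ennreal (M - m)" by (simp add: Liminf_const)
    finally show "(\<integral>\<^sup>+t. G t \<partial>lborel) \<le> ennreal (M - m)" .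
    fix t assume t: "a < t" "t < b"
    have "filterlim (\<lambda>n. t + h n) (at_right t) sequentially"
    proof -
      have "(\<lambda>n. t + h n) \<longlonglongrightarrow> t + 0" by (intro tendsto_intros h_lim)
      moreover have "t + h n \<noteq> t" "t + h n \<in> {t<..}" for n using h[of n] by auto
      ultimately show ?thesis by (auto simp: filterlim_at)
    qed
    then have lim: "(\<lambda>n. (A (t + h n) - A t) / (t + h n - t)) \<longlonglongrightarrow> D t"
      using deriv[OF t] unfolding has_field_derivative_iff by (rule filterlim_compose[rotated])
    \<comment> \<open>For such \<open>n\<close> the shifted argument is still inside the interval,
      where \<open>E\<close> agrees with \<open>A\<close>.\<close>
    have "\<forall>\<^sub>F n in sequentially. h n < b - t"
      using order_tendstoD(2)[OF h_lim, of "b - t"] t by simp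
    then have "\<forall>\<^sub>F n in sequentially. ennreal ((A (t + h n) - A t) / (t + h n - t)) = g n t"
    proof eventually_elim
      case (elim n)
      then show ?case using t h[of n] by (auto simp: g_def E_def)
    qed
    then have "(\<lambda>n. g n t) \<longlonglongrightarrow> ennreal (D t)"
      by (rule Lim_transform_eventually[OF tendsto_ennrealI[OF lim]])
    then show "ennreal (D t) \<le> G t"
      unfolding G_def by (simp add: lim_imp_Liminf)
  qed
qed

section \<open>Length of Lipschitz curves\<close>

text \<open>A partition ending at \<open>b\<close> is prolonged to one ending at \<open>c\<close>.
  Conversely, a partition ending at \<open>c\<close> is cut at \<open>b\<close>, and the polygon
  over its second part has length at most \<open>L * (c - b)\<close>.\<close>

lemma curve_length_Lipschitz:
  fixes \<gamma> :: "real \<Rightarrow> complex"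
  assumes lip: "\<And>s t. dist (\<gamma> s) (\<gamma> t) \<le> L * \<bar>s - t\<bar>" and ab: "a \<le> b" "b \<le> c"
  shows "curve_length \<gamma> a b \<le> curve_length \<gamma> a c"
    and "curve_length \<gamma> a c - curve_length \<gamma> a b \<le> L * (c - b)"
proof -
  define P where "P a b = {(\<Sum>i<n. dist (\<gamma> (p i)) (\<gamma> (p (Suc i)))) | (p :: nat \<Rightarrow> real) n.
            mono p \<and> p 0 = a \<and> p n = b}" for a b
  have len: "curve_length \<gamma> a b = Sup (P a b)" for a b by (simp add: curve_length_def P_def)
  have upper: "(\<Sum>i<n. dist (\<gamma> (p i)) (\<gamma> (p (Suc i)))) \<le> L * (p n - p 0)" if "mono p" for p :: "nat \<Rightarrow> real" and n
  proof -
    have "(\<Sum>i<n. dist (\<gamma> (p i)) (\<gamma> (p (Suc i)))) \<le> (\<Sum>i<n. L * (p (Suc i) - p i))"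
    proof (rule sum_mono)
      fix i
      show "dist (\<gamma> (p i)) (\<gamma> (p (Suc i))) \<le> L * (p (Suc i) - p i)"
        using lip[of "p i" "p (Suc i)"] monoD[OF that, of i "Suc i"] by (simp add: abs_minus_commute)
    qed
    also have "\<dots> = L * (p n - p 0)" by (simp add: sum_distrib_left[symmetric] sum_lessThan_telescope)
    finally show ?thesis .
  qed
  have bdd: "bdd_above (P a b)" for a b
  proof (rule bdd_aboveI)
    fix x assume "x \<in> P a b"
    then obtain p n where "mono p" "p 0 = a" "p n = b"
      "x = (\<Sum>i<n. dist (\<gamma> (p i)) (\<gamma> (p (Suc i))))" unfolding P_def by blast
    then show "x \<le> L * (b - a)" using upper[of p n] by simp
  qed
  have ne: "P a b \<noteq> {}" if "a \<le> b" for a b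
  proof -
    define p where "p i = (if i = 0 then a else b)" for i :: nat
    have "mono p" "p 0 = a" "p 1 = b" using that by (auto simp: mono_def p_def)
    then have "(\<Sum>i<1. dist (\<gamma> (p i)) (\<gamma> (p (Suc i)))) \<in> P a b" unfolding P_def by blast
    then show ?thesis by blast
  qed
  show "curve_length \<gamma> a b \<le> curve_length \<gamma> a c"
    unfolding len
  proof (rule cSup_mono[OF ne[OF ab(1)] bdd])
    fix x assume "x \<in> P a b"
    then obtain p n where p: "mono p" "p 0 = a" "p n = b"
      and x: "x = (\<Sum>i<n. dist (\<gamma> (p i)) (\<gamma> (p (Suc i))))" unfolding P_def by blast
    \<comment> \<open>The values of \<open>p\<close> beyond \<open>n\<close> are constrained only by
      monotonicity and may exceed \<open>c\<close>; setting them to \<open>c\<close> also supplies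
      the new end point at \<open>Suc n\<close>.\<close>
    define p' where "p' i = (if i \<le> n then p i else c)" for i
    have "mono p'"
    proof (rule monoI)
      fix i j :: nat assume "i \<le> j"
      then have "p i \<le> p j" by (rule monoD[OF p(1)])
      moreover have "p i \<le> c" if "i \<le> n" using monoD[OF p(1) that] p(3) ab(2) by simp
      ultimately show "p' i \<le> p' j" using \<open>i \<le> j\<close> by (auto simp: p'_def)
    qed
    moreover have "p' 0 = a" "p' (Suc n) = c" using p by (auto simp: p'_def)
    ultimately have "(\<Sum>i<Suc n. dist (\<gamma> (p' i)) (\<gamma> (p' (Suc i)))) \<in> P a c"
      unfolding P_def by blast
    moreover have "x \<le> (\<Sum>i<Suc n. dist (\<gamma> (p' i)) (\<gamma> (p' (Suc i))))"
    proof -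
      have "x = (\<Sum>i<n. dist (\<gamma> (p' i)) (\<gamma> (p' (Suc i))))" unfolding x
        by (intro sum.cong) (auto simp: p'_def)
      then show ?thesis by simp
    qed
    ultimately show "\<exists>y\<in>P a c. x \<le> y" by blast
  qed
  have "curve_length \<gamma> a c \<le> curve_length \<gamma> a b + L * (c - b)"
    unfolding len
  proof (rule cSup_least[OF ne])
    fix x assume "x \<in> P a c"
    then obtain p n where p: "mono p" "p 0 = a" "p n = c"
      and x: "x = (\<Sum>i<n. dist (\<gamma> (p i)) (\<gamma> (p (Suc i))))" unfolding P_def by blast
    \<comment> \<open>Clamping at \<open>b\<close> gives the two parts. In a step across
      \<open>b\<close>, one part arrives at \<open>b\<close> and the other starts there, so the
      triangle inequality through \<open>\<gamma> b\<close> applies; in all other steps one part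
      stands still.\<close>
    define q where "q i = min (p i) b" for i
    define r where "r i = max (p i) b" for i
    have mono: "mono q" "mono r"
      unfolding q_def r_def using monoD[OF p(1)]
      by (auto intro!: monoI min.mono max.mono)
    have "x \<le> (\<Sum>i<n. dist (\<gamma> (q i)) (\<gamma> (q (Suc i))) + dist (\<gamma> (r i)) (\<gamma> (r (Suc i))))"
      unfolding x
    proof (rule sum_mono)
      fix i
      have "p i \<le> p (Suc i)" using monoD[OF p(1), of i "Suc i"] by simp
      then consider "p (Suc i) \<le> b" | "b \<le> p i" | "p i \<le> b" "b \<le> p (Suc i)" by linarith
      then show "dist (\<gamma> (p i)) (\<gamma> (p (Suc i)))
          \<le> dist (\<gamma> (q i)) (\<gamma> (q (Suc i))) + dist (\<gamma> (r i)) (\<gamma> (r (Suc i)))"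
        using \<open>p i \<le> p (Suc i)\<close> dist_triangle[of "\<gamma> (p i)" "\<gamma> (p (Suc i))" "\<gamma> b"]
        by cases (auto simp: q_def r_def min_absorb1 min_absorb2 max_absorb1 max_absorb2)
    qed
    also have "\<dots> = (\<Sum>i<n. dist (\<gamma> (q i)) (\<gamma> (q (Suc i)))) + (\<Sum>i<n. dist (\<gamma> (r i)) (\<gamma> (r (Suc i))))"
      by (rule sum.distrib)
    also have "\<dots> \<le> Sup (P a b) + L * (r n - r 0)"
    proof (intro add_mono upper mono cSup_upper bdd)
      have "q 0 = a" "q n = b" using p ab by (auto simp: q_def)
      then show "(\<Sum>i<n. dist (\<gamma> (q i)) (\<gamma> (q (Suc i)))) \<in> P a b"
        unfolding P_def using mono(1) by blast
    qed
    also have "r n - r 0 = c - b" using p ab by (auto simp: r_def)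
    finally show "x \<le> Sup (P a b) + L * (c - b)" .
  qed (use ab in simp)
  then show "curve_length \<gamma> a c - curve_length \<gamma> a b \<le> L * (c - b)" by simp
qed

section \<open>The boundary curve of a convex body\<close>

text \<open>The chord has length \<open>2 * \<bar>sin ((s - t) / 2)\<bar>\<close>, which is at most
  the arc.\<close>

lemma norm_cis_diff_le: "norm (cis s - cis t) \<le> \<bar>s - t\<bar>"
proof -
  have "(norm (cis s - cis t))\<^sup>2 = (2 * sin ((s - t) / 2))\<^sup>2"
  proof -
    have "(norm (cis s - cis t))\<^sup>2 = (cos s - cos t)\<^sup>2 + (sin s - sin t)\<^sup>2"
      by (simp add: cmod_power2)
    also have "\<dots> = ((cos s)\<^sup>2 + (sin s)\<^sup>2) + ((cos t)\<^sup>2 + (sin t)\<^sup>2) - 2 * cos (s - t)"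
      unfolding cos_diff by algebra
    also have "\<dots> = 2 - 2 * cos (s - t)" by simp
    also have "cos (s - t) = 1 - 2 * (sin ((s - t) / 2))\<^sup>2"
      using cos_double_sin[of "(s - t) / 2"] by (simp only: mult_2 field_sum_of_halves)
    also have "2 - 2 * (1 - 2 * (sin ((s - t) / 2))\<^sup>2) = (2 * sin ((s - t) / 2))\<^sup>2"
      by (simp add: power_mult_distrib)
    finally show ?thesis .
  qed
  also have "\<dots> = (2 * \<bar>sin ((s - t) / 2)\<bar>)\<^sup>2" by (simp add: power_mult_distrib)
  finally have "(norm (cis s - cis t))\<^sup>2 = (2 * \<bar>sin ((s - t) / 2)\<bar>)\<^sup>2" .
  then have "norm (cis s - cis t) = 2 * \<bar>sin ((s - t) / 2)\<bar>" by (rule power2_eq_imp_eq) auto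
  also have "\<dots> \<le> \<bar>s - t\<bar>" using abs_sin_x_le_abs_x[of "(s - t) / 2"] by simp
  finally show ?thesis .
qed

lemma tendsto_right_difference_quotient:
  fixes f :: "real \<Rightarrow> 'a::real_normed_vector"
  assumes "(f has_vector_derivative v) (at_right t)"
  shows "((\<lambda>u. (1 / (u - t)) *\<^sub>R (f u - f t)) \<longlongrightarrow> v) (at_right t)"
proof -
  have "((\<lambda>u. (1 / norm (u - t)) *\<^sub>R (f u - (f t + (u - t) *\<^sub>R v))) \<longlongrightarrow> 0) (at_right t)"
    using assms unfolding has_vector_derivative_def has_derivative_within by blast
  moreover have "\<forall>\<^sub>F u in at_right t. (1 / norm (u - t)) *\<^sub>R (f u - (f t + (u - t) *\<^sub>R v))
      = (1 / (u - t)) *\<^sub>R (f u - f t) - v"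
    by (auto simp: eventually_at_filter scaleR_diff_right scaleR_add_right)
  ultimately have "((\<lambda>u. (1 / (u - t)) *\<^sub>R (f u - f t) - v) \<longlongrightarrow> 0) (at_right t)"
    by (rule Lim_transform_eventually)
  then show ?thesis by (rule LIM_zero_cancel)
qed

lemma mono_bounded_tendsto_at_right:
  fixes f :: "real \<Rightarrow> real"
  assumes mono: "\<And>x y. a < x \<Longrightarrow> x < y \<Longrightarrow> y < b \<Longrightarrow> f x \<le> f y"
    and bound: "\<And>x. a < x \<Longrightarrow> x < b \<Longrightarrow> m \<le> f x" and ab: "a < b"
  shows "\<exists>l. (f \<longlongrightarrow> l) (at_right a)"
proof -
  define l where "l = (INF x\<in>{a<..<b}. f x)"
  have bdd: "bdd_below (f ` {a<..<b})" using bound by (auto intro!: bdd_belowI[of _ m])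
  have "(f \<longlongrightarrow> l) (at_right a)"
  proof (rule order_tendstoI)
    fix c assume c: "c < l"
    have "c < f x" if "a < x" "x < b" for x
      using cINF_lower[OF bdd, of x] c that unfolding l_def by auto
    then show "\<forall>\<^sub>F x in at_right a. c < f x"
      using eventually_at_right[OF ab] ab by blast
  next
    fix c assume "l < c"
    then obtain y where y: "a < y" "y < b" "f y < c"
      using ab cINF_less_iff[OF _ bdd, of c] unfolding l_def by auto
    then have "f x < c" if "a < x" "x < y" for x
      using mono[OF that(1,2) y(2)] by simp
    then show "\<forall>\<^sub>F x in at_right a. f x < c"
      using eventually_at_right[OF y(1)] y(1) by blast
  qed
  then show ?thesis ..
qed

section \<open>Polar coordinates and the gauge function\<close>

locale convex_body =
  fixes \<Omega> :: "complex set"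
  assumes compact: "compact \<Omega>" and convex: "convex \<Omega>" and interior: "interior \<Omega> \<noteq> {}"
begin

abbreviation "z \<equiv> center \<Omega>"
abbreviation "\<gamma> \<equiv> boundary_curve \<Omega>"

definition rad :: "real \<Rightarrow> real" where
  "rad t = Sup {r. z + of_real r * cis t \<in> \<Omega>}"

text \<open>The gauge function of the body on the unit circle around the centre.\<close>

definition q :: "real \<Rightarrow> real" where
  "q t = inverse (rad t)"

lemma curve_eq: "\<gamma> t = z + of_real (rad t) * cis t"
  by (simp add: boundary_curve_def rad_def)

lemma rad_pos: "rad t > 0"
  using boundary_curve_ray(1)[OF compact convex interior] by (simp add: rad_def)

lemma q_pos: "q t > 0"
  by (simp add: q_def rad_pos)

lemma curve_in_frontier: "\<gamma> t \<in> frontier \<Omega>"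
  by (rule boundary_curve_ray(2)[OF compact convex interior])

lemma curve_mem: "\<gamma> t \<in> \<Omega>"
  using curve_in_frontier frontier_subset_closed compact_imp_closed[OF compact] by blast

lemma le_rad: "z + of_real s * cis t \<in> \<Omega> \<Longrightarrow> s \<le> rad t"
  using boundary_curve_ray(4)[OF compact convex interior, of t s] by (fastforce simp: rad_def)

lemma rad_bounds:
  obtains a b where "a > 0" "\<And>t. a \<le> rad t" "\<And>t. rad t \<le> b"
proof -
  have "z \<in> interior \<Omega>" using interior unfolding center_def by (metis ex_in_conv someI_ex)
  then obtain e where e: "e > 0" "cball z e \<subseteq> \<Omega>" by (meson mem_interior_cball)
  have "e \<le> rad t" for t
    using e by (intro le_rad subsetD[OF e(2)]) (auto simp: dist_norm norm_mult)
  moreover obtain B where B: "\<And>x. x \<in> \<Omega> \<Longrightarrow> norm x \<le> B"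
    using compact_imp_bounded[OF compact] bounded_iff by metis
  have "rad t \<le> B + norm z" for t
  proof -
    have "rad t = norm (\<gamma> t - z)" using rad_pos[of t] by (simp add: curve_eq norm_mult)
    also have "\<dots> \<le> norm (\<gamma> t) + norm z" by (rule norm_triangle_ineq4)
    finally show ?thesis using B[OF curve_mem[of t]] by simp
  qed
  ultimately show thesis using that e(1) by blast
qed

lemma q_bounded: obtains Q where "Q > 0" "\<And>t. q t \<le> Q"
proof -
  obtain a where "a > 0" "\<And>t. a \<le> rad t" using rad_bounds by metis
  then have "q t \<le> inverse a" for t unfolding q_def by (intro le_imp_inverse_le)
  then show thesis using that[of "inverse a"] \<open>a > 0\<close> by simp
qed

lemma rad_periodic: "rad (t + 2 * pi) = rad t"
  by (simp add: rad_def cis_mult[symmetric])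

lemma curve_periodic: "\<gamma> (t + 2 * pi) = \<gamma> t"
  by (simp add: curve_eq rad_periodic cis_mult[symmetric])

text \<open>The chord between the points of parameters \<open>t - x\<close> and \<open>t + y\<close> lies in \<open>\<Omega>\<close>;
  compare the point where it meets the ray of direction \<open>t\<close> with the boundary.\<close>

lemma q_trig_convex:
  assumes "0 < x" "0 < y" "x + y < pi"
  shows "q t * sin (x + y) \<le> q (t - x) * sin y + q (t + y) * sin x"
proof -
  have pos: "sin x > 0" "sin y > 0" using assms by (auto intro!: sin_gt_zero)
  \<comment> \<open>The weights \<open>u\<close> and \<open>v\<close> are chosen so that, after
    multiplication by the radii, they are proportional to \<open>sin y\<close> and
    \<open>sin x\<close>, the coefficients for which the two directions add up to a multiple of
    \<open>cis t\<close>. Dividing by \<open>S\<close> makes their sum 1.\<close>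
  define S where "S = q (t - x) * sin y + q (t + y) * sin x"
  have S: "S > 0" unfolding S_def using pos q_pos by (simp add: add_pos_pos)
  define u where "u = q (t - x) * sin y / S"
  define v where "v = q (t + y) * sin x / S"
  have uv: "u + v = 1" "u \<ge> 0" "v \<ge> 0"
    using S pos q_pos[of "t - x"] q_pos[of "t + y"]
    by (auto simp: u_def v_def add_divide_distrib[symmetric] S_def[symmetric])
  have coeff: "u * rad (t - x) = sin y / S" "v * rad (t + y) = sin x / S"
    using rad_pos[of "t - x"] rad_pos[of "t + y"] by (auto simp: u_def v_def q_def field_simps)
  have cis: "of_real (sin y) * cis (t - x) + of_real (sin x) * cis (t + y) = of_real (sin (x + y)) * cis t"
    by (auto simp: complex_eq_iff cos_add cos_diff sin_add sin_diff algebra_simps)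
  have "u *\<^sub>R \<gamma> (t - x) + v *\<^sub>R \<gamma> (t + y) \<in> \<Omega>"
    by (rule convexD[OF convex curve_mem curve_mem uv(2,3,1)])
  also have "u *\<^sub>R \<gamma> (t - x) + v *\<^sub>R \<gamma> (t + y)
      = (u + v) *\<^sub>R z + (of_real (u * rad (t - x)) * cis (t - x) + of_real (v * rad (t + y)) * cis (t + y))"
    unfolding curve_eq by (simp add: scaleR_conv_of_real algebra_simps)
  also have "\<dots> = z + of_real (sin (x + y) / S) * cis t"
    unfolding coeff uv(1) of_real_divide
    by (simp add: cis[symmetric] add_divide_distrib)
  finally have "sin (x + y) / S \<le> rad t" by (rule le_rad)
  then show ?thesis
    unfolding S_def[symmetric] using S rad_pos[of t] by (simp add: q_def field_simps)
qed

section \<open>Regularity of the boundary curve\<close>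

text \<open>Two instances of \<open>q_trig_convex\<close> with an auxiliary point a right angle
  away: \<open>t + h\<close> lies between \<open>t\<close> and \<open>t + pi / 2\<close>, and
  \<open>t\<close> lies between \<open>t - pi / 2\<close> and \<open>t + h\<close>. The strict
  conditions on the angles fail for \<open>h = pi / 2\<close>, which is treated directly.\<close>

lemma q_increment_le:
  assumes Q: "\<And>t. q t \<le> Q" and h: "0 < h" "h \<le> pi / 2"
  shows "\<bar>q (t + h) - q t * cos h\<bar> \<le> Q * sin h"
proof (cases "h = pi / 2")
  case True
  show ?thesis unfolding True using Q[of "t + pi / 2"] q_pos[of "t + pi / 2"] by simp
next
  case False
  then have h': "h < pi / 2" using h by simp
  have s: "sin h > 0" using h by (intro sin_gt_zero) auto
  have "q (t + h) * sin (h + (pi / 2 - h)) \<le> q (t + h - h) * sin (pi / 2 - h) + q (t + h + (pi / 2 - h)) * sin h"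
    using h h' by (intro q_trig_convex) auto
  then have "q (t + h) \<le> q t * cos h + q (t + pi / 2) * sin h"
    by (simp add: sin_diff)
  moreover have "q (t + pi / 2) * sin h \<le> Q * sin h" using Q s by (intro mult_right_mono) auto
  moreover have "q t * sin (pi / 2 + h) \<le> q (t - pi / 2) * sin h + q (t + h) * sin (pi / 2)"
    using h h' by (intro q_trig_convex) auto
  then have "q t * cos h \<le> q (t - pi / 2) * sin h + q (t + h)" by (simp add: sin_add)
  moreover have "q (t - pi / 2) * sin h \<le> Q * sin h" using Q s by (intro mult_right_mono) auto
  ultimately show ?thesis by linarith
qed

text \<open>The quotient \<open>f\<close> plays the role of the secant slope of a convex function:
  by \<open>q_trig_convex\<close> it increases with \<open>h\<close>, and by
  \<open>q_increment_le\<close> it is bounded below, so it converges. The limits of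
  \<open>sin h / h\<close> and \<open>(cos h - 1) / h\<close> turn it into the ordinary difference
  quotient.\<close>

lemma q_right_derivative: "\<exists>d. (q has_real_derivative d) (at_right t)"
proof -
  obtain Q where Q: "Q > 0" "\<And>t. q t \<le> Q" using q_bounded by blast
  define f where "f h = (q (t + h) - q t * cos h) / sin h" for h
  have "\<exists>l. (f \<longlongrightarrow> l) (at_right 0)"
  proof (rule mono_bounded_tendsto_at_right)
    show "(0::real) < pi / 2" by simp
    fix h :: real assume h: "0 < h" "h < pi / 2"
    have s: "sin h > 0" using h by (intro sin_gt_zero) auto
    have "- (Q * sin h) \<le> q (t + h) - q t * cos h"
      using q_increment_le[OF Q(2), of h t] h by linarith
    then show "- Q \<le> f h" using s by (simp add: f_def field_simps)
  next
    fix h k :: real assume hk: "0 < h" "h < k" "k < pi / 2"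
    have s: "sin h > 0" "sin k > 0" using hk by (auto intro!: sin_gt_zero)
    have "q (t + h) * sin (h + (k - h)) \<le> q (t + h - h) * sin (k - h) + q (t + h + (k - h)) * sin h"
      using hk by (intro q_trig_convex) auto
    then have "(q (t + h) - q t * cos h) * sin k \<le> (q (t + k) - q t * cos k) * sin h"
      by (simp add: sin_diff algebra_simps)
    then show "f h \<le> f k" using s by (simp add: f_def field_simps)
  qed
  then obtain l where l: "(f \<longlongrightarrow> l) (at_right 0)" by blast
  have "(sin has_real_derivative 1) (at_right 0)" "(cos has_real_derivative 0) (at_right 0)"
    by (auto intro!: derivative_eq_intros)
  then have sc: "((\<lambda>h::real. sin h / h) \<longlongrightarrow> 1) (at_right 0)" "((\<lambda>h::real. (cos h - 1) / h) \<longlongrightarrow> 0) (at_right 0)"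
    by (simp_all add: has_field_derivative_iff)
  have "((\<lambda>h. f h * (sin h / h) + q t * ((cos h - 1) / h)) \<longlongrightarrow> l * 1 + q t * 0) (at_right 0)"
    by (intro tendsto_intros l sc)
  moreover have "\<forall>\<^sub>F h in at_right 0. f h * (sin h / h) + q t * ((cos h - 1) / h) = (q (t + h) - q t) / h"
  proof -
    have "f h * (sin h / h) + q t * ((cos h - 1) / h) = (q (t + h) - q t) / h" if "0 < h" "h < pi" for h
    proof -
      have "sin h > 0" using that by (rule sin_gt_zero)
      then show ?thesis using that by (simp add: f_def field_simps)
    qed
    then show ?thesis using eventually_at_right[of 0 pi] pi_gt_zero by blast
  qed
  ultimately have "((\<lambda>h. (q (t + h) - q t) / h) \<longlongrightarrow> l) (at_right 0)"
    by (simp add: Lim_transform_eventually)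
  then have "((\<lambda>u. (q u - q t) / (u - t)) \<longlongrightarrow> l) (at_right t)"
    by (subst filterlim_at_right_to_0) (simp add: add.commute)
  then show ?thesis by (auto simp: has_field_derivative_iff)
qed

text \<open>In the frame rotated by \<open>cis t\<close>, the derivative is
  \<open>Complex d' (rad t)\<close>: its component across the ray is the radius. This bounds the
  speed from below.\<close>

lemma curve_right_derivative:
  obtains v where "(\<gamma> has_vector_derivative v) (at_right t)" "rad t \<le> norm v"
proof -
  obtain d where d: "(q has_real_derivative d) (at_right t)" using q_right_derivative by blast
  have "rad = (\<lambda>u. inverse (q u))" by (simp add: q_def)
  moreover have "((\<lambda>u. inverse (q u)) has_real_derivative - (d * inverse ((q t)\<^sup>2))) (at_right t)"
    using DERIV_inverse_fun[OF d] q_pos[of t] by (simp add: power2_eq_square)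
  ultimately obtain d' where d': "(rad has_real_derivative d') (at_right t)" by auto
  have "((\<lambda>u. z + of_real (rad u) * cis u) has_vector_derivative
      (of_real (rad t) * (\<i> * cis t) + of_real d' * cis t)) (at_right t)"
  proof -
    have "(cis has_vector_derivative (\<i> * cis t)) (at_right t)"
      using has_derivative_cis[of "\<lambda>x. x" "\<lambda>x. x" t "{t<..}"]
      by (simp add: has_vector_derivative_def)
    then show ?thesis
      using has_vector_derivative_add[OF has_vector_derivative_const[of z]
          has_vector_derivative_mult[OF has_vector_derivative_of_real[OF d']]] by force
  qed
  then have "(\<gamma> has_vector_derivative (of_real (rad t) * (\<i> * cis t) + of_real d' * cis t)) (at_right t)"
    by (simp add: curve_eq[abs_def])
  moreover have "rad t \<le> norm (of_real (rad t) * (\<i> * cis t) + of_real d' * cis t)"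
  proof -
    have "of_real (rad t) * (\<i> * cis t) + of_real d' * cis t = cis t * Complex d' (rad t)"
      by (simp add: Complex_eq algebra_simps)
    then have "norm (of_real (rad t) * (\<i> * cis t) + of_real d' * cis t) = norm (Complex d' (rad t))"
      by (simp add: norm_mult)
    then show ?thesis using abs_Im_le_cmod[of "Complex d' (rad t)"] by simp
  qed
  ultimately show thesis by (rule that)
qed

text \<open>\<open>sgn\<close> ignores the positive factor \<open>1 / (u - t)\<close>, so the limit
  of directions is the direction of the one-sided derivative.\<close>

lemma tangent_out_curve:
  assumes t: "t \<in> {0..<2 * pi}" and v: "(\<gamma> has_vector_derivative v) (at_right t)" "v \<noteq> 0"
  shows "tangent_out \<Omega> (\<gamma> t) = sgn v"
proof -
  have "boundary_param \<Omega> (\<gamma> t) = t"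
    unfolding boundary_param_def
    using bij_betw_boundary_curve[OF compact convex interior] t
    by (auto simp: bij_betw_def intro: inv_into_f_f)
  moreover have "((\<lambda>u. sgn (\<gamma> u - \<gamma> t)) \<longlongrightarrow> sgn v) (at_right t)"
  proof (rule Lim_transform_eventually)
    show "((\<lambda>u. sgn ((1 / (u - t)) *\<^sub>R (\<gamma> u - \<gamma> t))) \<longlongrightarrow> sgn v) (at_right t)"
      by (intro tendsto_sgn tendsto_right_difference_quotient v)
    show "\<forall>\<^sub>F u in at_right t. sgn ((1 / (u - t)) *\<^sub>R (\<gamma> u - \<gamma> t)) = sgn (\<gamma> u - \<gamma> t)"
      by (auto simp: eventually_at_filter sgn_scaleR)
  qed
  ultimately show ?thesis
    by (simp add: tangent_out_def Let_def tendsto_Lim)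
qed

text \<open>For steps up to \<open>pi / 2\<close>, \<open>q_increment_le\<close> gives
  \<open>q\<close> the constant \<open>2 * Q\<close>, and passing to the reciprocal costs a factor
  of at most \<open>R\<^sup>2\<close>; the rotation of the ray adds \<open>R\<close>. Longer steps
  are covered by the diameter bound \<open>2 * R\<close>.\<close>

lemma curve_Lipschitz:
  obtains L where "L \<ge> 0" "\<And>s t. dist (\<gamma> s) (\<gamma> t) \<le> L * \<bar>s - t\<bar>"
proof -
  obtain Q where Q: "Q > 0" "\<And>t. q t \<le> Q" using q_bounded by blast
  obtain R where R: "\<And>t. rad t \<le> R" using rad_bounds by metis
  have R0: "R > 0" using R[of 0] rad_pos[of 0] by linarith
  define L where "L = 2 * Q * R\<^sup>2 + 2 * R"
  have L: "dist (\<gamma> (t + h)) (\<gamma> t) \<le> L * h" if h: "0 < h" for t h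
  proof (cases "h \<le> pi / 2")
    case True
    have "\<bar>q (t + h) - q t\<bar> \<le> 2 * Q * h"
    proof -
      have "1 - cos h \<le> h"
        using norm_cis_diff_le[of h 0] abs_Re_le_cmod[of "cis h - cis 0"] h by simp
      then have "q t * (1 - cos h) \<le> Q * h"
        using Q q_pos[of t] by (intro mult_mono) (auto simp: less_imp_le)
      moreover have "q t * (1 - cos h) \<ge> 0" using q_pos[of t] by simp
      moreover have "Q * sin h \<le> Q * h" using Q(1) h sin_x_le_x[of h] by (intro mult_left_mono) auto
      ultimately show ?thesis
        using q_increment_le[OF Q(2) h True, of t] by (simp add: algebra_simps)
    qed
    moreover have "rad (t + h) - rad t = (q t - q (t + h)) * (rad t * rad (t + h))"
      using rad_pos[of t] rad_pos[of "t + h"] by (simp add: q_def field_simps)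
    then have "\<bar>rad (t + h) - rad t\<bar> = \<bar>q (t + h) - q t\<bar> * (rad t * rad (t + h))"
      using rad_pos[of t] rad_pos[of "t + h"] by (simp add: abs_mult abs_minus_commute)
    moreover have "rad t * rad (t + h) \<le> R\<^sup>2"
      using R rad_pos[of t] rad_pos[of "t + h"] R0 unfolding power2_eq_square
      by (intro mult_mono) (auto simp: less_imp_le)
    ultimately have 1: "\<bar>rad (t + h) - rad t\<bar> \<le> (2 * Q * h) * R\<^sup>2"
      using rad_pos[of t] rad_pos[of "t + h"] by (simp add: mult_mono)
    have "\<gamma> (t + h) - \<gamma> t = of_real (rad (t + h) - rad t) * cis (t + h) + of_real (rad t) * (cis (t + h) - cis t)"
      by (simp add: curve_eq algebra_simps)
    then have "dist (\<gamma> (t + h)) (\<gamma> t)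
        \<le> norm (of_real (rad (t + h) - rad t) * cis (t + h)) + norm (of_real (rad t) * (cis (t + h) - cis t))"
      unfolding dist_norm by (metis norm_triangle_ineq)
    also have "\<dots> = \<bar>rad (t + h) - rad t\<bar> + rad t * norm (cis (t + h) - cis t)"
      using rad_pos[of t] by (simp add: norm_mult del: of_real_diff)
    also have "\<dots> \<le> (2 * Q * h) * R\<^sup>2 + R * h"
      using 1 R R0 norm_cis_diff_le[of "t + h" t] h rad_pos[of t]
      by (intro add_mono mult_mono) (auto simp: less_imp_le)
    also have "\<dots> \<le> L * h" using R0 h by (simp add: L_def algebra_simps)
    finally show ?thesis .
  next
    case False
    have "dist (\<gamma> (t + h)) (\<gamma> t) \<le> dist (\<gamma> (t + h)) z + dist (\<gamma> t) z" by (rule dist_triangle2)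
    also have "\<dots> = rad (t + h) + rad t"
      using rad_pos[of t] rad_pos[of "t + h"] by (simp add: curve_eq dist_norm norm_mult)
    also have "\<dots> \<le> 2 * R * 1" using R[of "t + h"] R[of t] by simp
    also have "\<dots> \<le> 2 * R * h" using False pi_gt3 R0 by (intro mult_left_mono) auto
    also have "\<dots> \<le> L * h" using Q(1) h by (simp add: L_def algebra_simps)
    finally show ?thesis .
  qed
  have "dist (\<gamma> s) (\<gamma> t) \<le> L * \<bar>s - t\<bar>" for s t
    using L[of "s - t" t] L[of "t - s" s] by (cases s t rule: linorder_cases) (auto simp: dist_commute)
  moreover have "L \<ge> 0" using Q(1) R0 by (simp add: L_def)
  ultimately show thesis using that by blast
qed

lemma continuous_on_curve: "continuous_on S \<gamma>"
proof -
  obtain L where "L \<ge> 0" "\<And>s t. dist (\<gamma> s) (\<gamma> t) \<le> L * \<bar>s - t\<bar>" using curve_Lipschitz by blast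
  then have "L-lipschitz_on S \<gamma>" by (auto intro!: lipschitz_onI simp: dist_real_def)
  then show ?thesis by (rule lipschitz_on_continuous_on)
qed

end

section \<open>Boundedness of the masses\<close>

text \<open>The cross product is \<open>norm w1 * norm w2 * sin (Arg w2 - Arg w1)\<close>. In a
  common open half-plane the arguments differ by less than \<open>pi\<close>, so the sine has the
  sign of their difference.\<close>

lemma Arg_le_if_cross_nonneg:
  assumes same: "Im w1 > 0 \<and> Im w2 > 0 \<or> Im w1 < 0 \<and> Im w2 < 0"
    and cross: "Re w1 * Im w2 - Im w1 * Re w2 \<ge> 0"
  shows "Arg w1 \<le> Arg w2"
proof (rule ccontr)
  assume "\<not> ?thesis"
  then have less: "Arg w2 - Arg w1 < 0" by simp
  have polar: "Re w = norm w * cos (Arg w)" "Im w = norm w * sin (Arg w)" for w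
    using rcis_cmod_Arg[of w] Re_rcis[of "norm w" "Arg w"] Im_rcis[of "norm w" "Arg w"] by auto
  have "0 < Arg w1 \<and> Arg w1 < pi \<and> 0 < Arg w2 \<and> Arg w2 < pi
      \<or> - pi < Arg w1 \<and> Arg w1 < 0 \<and> - pi < Arg w2 \<and> Arg w2 < 0"
    using same Arg_lt_pi[of w1] Arg_lt_pi[of w2] Arg_less_0[of w1] Arg_less_0[of w2]
      Arg_bounded[of w1] Arg_bounded[of w2] by auto
  then have "- pi < Arg w2 - Arg w1" by auto
  then have "sin (Arg w2 - Arg w1) < 0" using less sin_gt_zero[of "Arg w1 - Arg w2"]
      sin_minus[of "Arg w1 - Arg w2"] by simp
  moreover have "norm w1 > 0" "norm w2 > 0" using same by auto
  ultimately have "norm w1 * norm w2 * sin (Arg w2 - Arg w1) < 0" by (simp add: mult_pos_neg)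
  also have "norm w1 * norm w2 * sin (Arg w2 - Arg w1) = Re w1 * Im w2 - Im w1 * Re w2"
  proof -
    have "Re w1 * Im w2 - Im w1 * Re w2 = norm w1 * cos (Arg w1) * (norm w2 * sin (Arg w2))
        - norm w1 * sin (Arg w1) * (norm w2 * cos (Arg w2))"
      by (simp only: polar[symmetric])
    then show ?thesis by (simp add: sin_diff algebra_simps)
  qed
  finally show False using cross by simp
qed

context convex_body
begin

text \<open>The point of parameter \<open>t\<close> as seen from the one of parameter \<open>\<tau>\<close>, turned so that the centre
  lies in the direction of the positive real axis.\<close>

definition view :: "real \<Rightarrow> real \<Rightarrow> complex" where
  "view \<tau> t = (\<gamma> t - \<gamma> \<tau>) / (z - \<gamma> \<tau>)"

lemma center_neq_curve: "z - \<gamma> \<tau> \<noteq> 0"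
  using rad_pos[of \<tau>] by (simp add: curve_eq)

lemma view_eq: "view \<tau> t = 1 - of_real (q \<tau> / q t) * cis (t - \<tau>)"
proof -
  have "cis t = cis (t - \<tau>) * cis \<tau>" by (simp add: cis_mult)
  moreover have "rad \<tau> \<noteq> 0" using rad_pos[of \<tau>] by simp
  ultimately show ?thesis
    by (simp add: view_def curve_eq q_def field_simps)
qed

lemma Re_view: "Re (view \<tau> t) = 1 - q \<tau> / q t * cos (t - \<tau>)"
  and Im_view: "Im (view \<tau> t) = - (q \<tau> / q t * sin (t - \<tau>))"
  by (simp_all add: view_eq del: of_real_divide)

lemma Im_view_sign:
  "\<tau> < t \<Longrightarrow> t < \<tau> + pi \<Longrightarrow> Im (view \<tau> t) < 0"
  "\<tau> + pi < t \<Longrightarrow> t < \<tau> + 2 * pi \<Longrightarrow> Im (view \<tau> t) > 0"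
proof -
  have r: "q \<tau> / q t > 0" by (simp add: q_pos)
  show "Im (view \<tau> t) < 0" if "\<tau> < t" "t < \<tau> + pi"
    unfolding Im_view using mult_pos_pos[OF r sin_gt_zero[of "t - \<tau>"]] that by simp
  have "Im (view \<tau> t) = q \<tau> / q t * sin (t - \<tau> - pi)" by (simp add: Im_view)
  then show "Im (view \<tau> t) > 0" if "\<tau> + pi < t" "t < \<tau> + 2 * pi"
    using mult_pos_pos[OF r sin_gt_zero[of "t - \<tau> - pi"]] that by simp
qed

lemma view_opposite: "view \<tau> (\<tau> + pi) = of_real (1 + q \<tau> / q (\<tau> + pi))"
  by (simp add: view_eq)

text \<open>The branch cut of \<open>Arg\<close> points away from the centre. The only parameter
  with a real value of \<open>view\<close> is the opposite one, and there the value is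
  positive.\<close>

lemma view_not_nonpos:
  assumes "\<tau> < t" "t < \<tau> + 2 * pi"
  shows "view \<tau> t \<notin> \<real>\<^sub>\<le>\<^sub>0"
proof
  assume "view \<tau> t \<in> \<real>\<^sub>\<le>\<^sub>0"
  then have *: "Im (view \<tau> t) = 0" "Re (view \<tau> t) \<le> 0" by (auto simp: complex_nonpos_Reals_iff)
  then have "t = \<tau> + pi" using Im_view_sign[of \<tau> t] assms by (cases t "\<tau> + pi" rule: linorder_cases) auto
  moreover have "1 + q \<tau> / q (\<tau> + pi) > 0" by (intro add_pos_pos divide_pos_pos) (auto simp: q_pos)
  ultimately show False using *(2) by (simp add: view_opposite)
qed

text \<open>Within each half-turn the cross product of the two views is, up to a positive factor,
  the defect in \<open>q_trig_convex\<close> for the three boundary points. Between the half-turns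
  the argument passes from nonpositive to nonnegative.\<close>

lemma Arg_view_mono:
  assumes "\<tau> < s" "s < t" "t < \<tau> + 2 * pi"
  shows "Arg (view \<tau> s) \<le> Arg (view \<tau> t)"
proof -
  have cross_eq: "Re (view \<tau> s) * Im (view \<tau> t) - Im (view \<tau> s) * Re (view \<tau> t)
      = q \<tau> / (q s * q t) * (q t * sin (s - \<tau>) - q s * sin (t - \<tau>) + q \<tau> * sin (t - s))"
  proof -
    have "sin (t - s) = sin ((t - \<tau>) - (s - \<tau>))" by simp
    also have "\<dots> = sin (t - \<tau>) * cos (s - \<tau>) - cos (t - \<tau>) * sin (s - \<tau>)" by (rule sin_diff)
    finally have sin_ts: "sin (t - s) = sin (t - \<tau>) * cos (s - \<tau>) - cos (t - \<tau>) * sin (s - \<tau>)" .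
    have "q s \<noteq> 0" "q t \<noteq> 0" using q_pos[of s] q_pos[of t] by auto
    then show ?thesis unfolding sin_ts Re_view Im_view by (simp add: field_simps)
  qed
  have nonneg: "q \<tau> / (q s * q t) \<ge> 0" using q_pos[of s] q_pos[of t] q_pos[of \<tau>] by simp
  consider "t < \<tau> + pi" | "\<tau> + pi < s" | "s \<le> \<tau> + pi" "\<tau> + pi \<le> t" by linarith
  then show ?thesis
  proof cases
    case 1
    show ?thesis
    proof (rule Arg_le_if_cross_nonneg)
      have "q s * sin ((s - \<tau>) + (t - s)) \<le> q (s - (s - \<tau>)) * sin (t - s) + q (s + (t - s)) * sin (s - \<tau>)"
        using 1 assms by (intro q_trig_convex) auto
      then show "0 \<le> Re (view \<tau> s) * Im (view \<tau> t) - Im (view \<tau> s) * Re (view \<tau> t)"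
        unfolding cross_eq by (intro mult_nonneg_nonneg nonneg) (simp add: algebra_simps)
      show "0 < Im (view \<tau> s) \<and> 0 < Im (view \<tau> t) \<or> Im (view \<tau> s) < 0 \<and> Im (view \<tau> t) < 0"
        using Im_view_sign(1)[of \<tau>] 1 assms by auto
    qed
  next
    case 2
    show ?thesis
    proof (rule Arg_le_if_cross_nonneg)
      \<comment> \<open>In the second half-turn the viewpoint is given the parameter
        \<open>\<tau> + 2 * pi\<close>, which brings all three parameters within an angle less than
        \<open>pi\<close>.\<close>
      have "q t * sin ((t - s) + (\<tau> + 2 * pi - t))
          \<le> q (t - (t - s)) * sin (\<tau> + 2 * pi - t) + q (t + (\<tau> + 2 * pi - t)) * sin (t - s)"
        using 2 assms by (intro q_trig_convex) auto
      moreover have "sin (\<tau> + 2 * pi - t) = - sin (t - \<tau>)"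
        using sin_periodic[of "\<tau> - t"] sin_minus[of "t - \<tau>"] by (simp add: algebra_simps)
      moreover have "sin ((t - s) + (\<tau> + 2 * pi - t)) = - sin (s - \<tau>)"
        using sin_periodic[of "\<tau> - s"] sin_minus[of "s - \<tau>"] by (simp add: algebra_simps)
      moreover have "q (t + (\<tau> + 2 * pi - t)) = q \<tau>" using rad_periodic[of \<tau>] by (simp add: q_def)
      ultimately show "0 \<le> Re (view \<tau> s) * Im (view \<tau> t) - Im (view \<tau> s) * Re (view \<tau> t)"
        unfolding cross_eq by (intro mult_nonneg_nonneg nonneg) simp
      show "0 < Im (view \<tau> s) \<and> 0 < Im (view \<tau> t) \<or> Im (view \<tau> s) < 0 \<and> Im (view \<tau> t) < 0"
        using Im_view_sign(2)[of \<tau>] 2 assms by auto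
    qed
  next
    case 3
    have zero: "Arg (view \<tau> (\<tau> + pi)) = 0"
      using q_pos[of \<tau>] q_pos[of "\<tau> + pi"] unfolding view_opposite Arg_eq_0 by (simp add: add_nonneg_nonneg)
    have "Arg (view \<tau> s) \<le> 0"
      using Im_view_sign(1)[of \<tau> s] Arg_less_0[of "view \<tau> s"] assms 3 zero
      by (cases "s = \<tau> + pi") auto
    moreover have "Arg (view \<tau> t) \<ge> 0"
      using Im_view_sign(2)[of \<tau> t] Arg_less_0[of "view \<tau> t"] assms 3 zero
      by (cases "t = \<tau> + pi") auto
    ultimately show ?thesis by linarith
  qed
qed

text \<open>Off the branch cut \<open>Arg\<close> is the imaginary part of \<open>Ln\<close>, and in
  the logarithmic derivative of \<open>view\<close> the constant factor \<open>c\<close>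
  cancels.\<close>

lemma Arg_view_right_derivative:
  assumes "\<tau> < t" "t < \<tau> + 2 * pi" and v: "(\<gamma> has_vector_derivative v) (at_right t)"
  shows "((\<lambda>u. Arg (view \<tau> u)) has_real_derivative Im (v / (\<gamma> t - \<gamma> \<tau>))) (at_right t)"
proof -
  define c where "c = inverse (z - \<gamma> \<tau>)"
  have view: "view \<tau> u = (\<gamma> u - \<gamma> \<tau>) * c" for u by (simp add: view_def c_def divide_inverse)
  have c: "c \<noteq> 0" using center_neq_curve by (simp add: c_def)
  have "(view \<tau> has_vector_derivative v * c) (at_right t)"
    unfolding view using v by (auto intro!: derivative_eq_intros)
  then have "((Ln \<circ> view \<tau>) has_vector_derivative (v * c) * inverse (view \<tau> t)) (at_right t)"
    by (rule field_vector_diff_chain_within)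
      (rule has_field_derivative_at_within[OF has_field_derivative_Ln[OF view_not_nonpos[OF assms(1,2)]]])
  moreover have "(v * c) * inverse (view \<tau> t) = v / (\<gamma> t - \<gamma> \<tau>)"
    using c by (simp add: view divide_inverse)
  ultimately have "((\<lambda>u. Im (Ln (view \<tau> u))) has_vector_derivative Im (v / (\<gamma> t - \<gamma> \<tau>))) (at_right t)"
    using bounded_linear.has_vector_derivative[OF bounded_linear_Im] by (fastforce simp: o_def)
  then have "((\<lambda>u. Im (Ln (view \<tau> u))) has_real_derivative Im (v / (\<gamma> t - \<gamma> \<tau>))) (at_right t)"
    by (simp add: has_real_derivative_iff_has_vector_derivative)
  then have lim: "((\<lambda>u. (Im (Ln (view \<tau> u)) - Im (Ln (view \<tau> t))) / (u - t)) \<longlongrightarrow> Im (v / (\<gamma> t - \<gamma> \<tau>))) (at_right t)"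
    by (simp add: has_field_derivative_iff)
  have Arg: "Arg (view \<tau> u) = Im (Ln (view \<tau> u))" if "t \<le> u" "u < \<tau> + 2 * pi" for u
    using view_not_nonpos[of \<tau> u] that assms(1) by (intro Arg_eq_Im_Ln) auto
  have "\<forall>\<^sub>F u in at_right t. (Im (Ln (view \<tau> u)) - Im (Ln (view \<tau> t))) / (u - t)
      = (Arg (view \<tau> u) - Arg (view \<tau> t)) / (u - t)"
    using eventually_at_right[OF assms(2)] assms(2) Arg by auto
  then show ?thesis
    unfolding has_field_derivative_iff by (rule Lim_transform_eventually[OF lim])
qed

text \<open>\<open>Arg (view \<tau> t)\<close> is monotone in \<open>t\<close> and takes values
  between \<open>- pi\<close> and \<open>pi\<close>, so \<open>right_derivative_dominated\<close>
  gives total mass at most \<open>2 * pi\<close>. Uniqueness of limits extends the bound from the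
  chosen \<open>V\<close> to any derivative \<open>v\<close>.\<close>

lemma turning_dominated:
  obtains G where "G \<in> borel_measurable lborel" "(\<integral>\<^sup>+t. G t \<partial>lborel) \<le> ennreal (2 * pi)"
    "\<And>t v. \<tau> < t \<Longrightarrow> t < \<tau> + 2 * pi \<Longrightarrow> (\<gamma> has_vector_derivative v) (at_right t) \<Longrightarrow>
      ennreal (Im (v / (\<gamma> t - \<gamma> \<tau>))) \<le> G t"
proof -
  define V where "V t = (SOME v. (\<gamma> has_vector_derivative v) (at_right t))" for t
  have V: "(\<gamma> has_vector_derivative V t) (at_right t)" for t
    unfolding V_def using curve_right_derivative[of t] by (metis someI)
  have unique: "v = V t" if "(\<gamma> has_vector_derivative v) (at_right t)" for v t
    using tendsto_right_difference_quotient[OF that] tendsto_right_difference_quotient[OF V]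
    by (intro tendsto_unique) auto
  have mono: "mono_on {\<tau><..<\<tau> + 2 * pi} (\<lambda>t. Arg (view \<tau> t))"
  proof (rule mono_onI)
    fix r s assume "r \<in> {\<tau><..<\<tau> + 2 * pi}" "s \<in> {\<tau><..<\<tau> + 2 * pi}" "r \<le> s"
    then show "Arg (view \<tau> r) \<le> Arg (view \<tau> s)" using Arg_view_mono[of \<tau> r s] by (cases "r = s") auto
  qed
  have bounds: "- pi \<le> Arg w \<and> Arg w \<le> pi" for w using Arg_bounded[of w] by auto
  obtain G where "G \<in> borel_measurable lborel" "(\<integral>\<^sup>+t. G t \<partial>lborel) \<le> ennreal (pi - - pi)"
    "\<And>t. \<tau> < t \<Longrightarrow> t < \<tau> + 2 * pi \<Longrightarrow> ennreal (Im (V t / (\<gamma> t - \<gamma> \<tau>))) \<le> G t"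
    by (rule right_derivative_dominated[OF mono, of "- pi" pi "\<lambda>t. Im (V t / (\<gamma> t - \<gamma> \<tau>))"])
      (use bounds Arg_view_right_derivative[OF _ _ V] in auto)
  then show thesis using unique by (intro that[of G]) auto
qed

section \<open>From the viewing angle to the density\<close>

lemma measurable_curve: "\<gamma> \<in> measurable borel (restrict_space borel (frontier \<Omega>))"
  using curve_in_frontier
  by (intro measurable_restrict_space2 borel_measurable_continuous_onI continuous_on_curve) auto

text \<open>The factor \<open>- \<i>\<close> between tangent and normal exchanges real and imaginary
  parts: the quotient is the derivative of the viewing angle divided by the speed
  \<open>norm v\<close>.\<close>

lemma Re_normal_quotient:
  assumes "t \<in> {0..<2 * pi}" "(\<gamma> has_vector_derivative v) (at_right t)" "v \<noteq> 0"
  shows "Re (outward_normal \<Omega> (\<gamma> t) / (\<gamma> t - \<zeta>)) = Im (v / (\<gamma> t - \<zeta>)) / norm v"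
proof -
  define w where "w = v / (\<gamma> t - \<zeta>)"
  have "outward_normal \<Omega> (\<gamma> t) / (\<gamma> t - \<zeta>) = - \<i> * (of_real (1 / norm v) * w)"
    using tangent_out_curve[OF assms]
    by (simp add: outward_normal_def w_def sgn_div_norm scaleR_conv_of_real divide_inverse)
  also have "Re \<dots> = Im w / norm v" by simp
  finally show ?thesis by (simp only: w_def)
qed

lemma np_density_curve_le:
  assumes t: "t \<in> {0..<2 * pi}" and a: "0 < a" "a \<le> rad t"
    and v: "(\<gamma> has_vector_derivative v) (at_right t)" "rad t \<le> norm v"
  shows "ennreal (np_density \<Omega> \<zeta> (\<gamma> t)) \<le> ennreal (1 / (pi * a)) * ennreal (Im (v / (\<gamma> t - \<zeta>)))"
proof -
  define y where "y = Im (v / (\<gamma> t - \<zeta>))"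
  have "v \<noteq> 0" using a v(2) by auto
  then have density: "np_density \<Omega> \<zeta> (\<gamma> t) = 0 \<or> np_density \<Omega> \<zeta> (\<gamma> t) = y / (pi * norm v)"
    using Re_normal_quotient[OF t v(1), of \<zeta>] by (simp add: np_density_def y_def)
  \<comment> \<open>Replacing \<open>y\<close> by \<open>max y 0\<close> permits the speed to be
    replaced by its lower bound \<open>a\<close>; \<open>ennreal\<close> identifies the two
    afterwards.\<close>
  have "np_density \<Omega> \<zeta> (\<gamma> t) \<le> 1 / (pi * a) * max y 0"
  proof -
    have "y / (pi * norm v) \<le> max y 0 / (pi * norm v)" by (intro divide_right_mono) auto
    also have "\<dots> \<le> max y 0 / (pi * a)"
      using a v(2) \<open>v \<noteq> 0\<close> by (intro divide_left_mono mult_left_mono mult_pos_pos) auto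
    finally show ?thesis using density a(1) by auto
  qed
  then have "ennreal (np_density \<Omega> \<zeta> (\<gamma> t)) \<le> ennreal (1 / (pi * a) * max y 0)" by (rule ennreal_leI)
  also have "\<dots> = ennreal (1 / (pi * a)) * ennreal (max y 0)" using a(1) by (intro ennreal_mult) auto
  also have "ennreal (max y 0) = ennreal y" by (auto simp: max_def ennreal_neg)
  finally show ?thesis by (simp only: y_def)
qed

text \<open>If the description of \<^const>\<open>alpha_plus\<close> has no witness, then its value is the constant \<open>J\<close>.\<close>

lemma corner_mass_bounded: "\<exists>K. \<forall>\<zeta>. 1 - interior_angle \<Omega> \<zeta> / pi \<le> K"
proof -
  define J where "J = (THE a::real. False)"
  have diff: "alpha_plus \<Omega> \<zeta> - alpha_minus \<Omega> \<zeta> \<le> \<bar>J\<bar> + pi" for \<zeta>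
  proof -
    define P where "P a \<longleftrightarrow> cis a = tangent_out \<Omega> \<zeta> \<and> 0 \<le> a - alpha_minus \<Omega> \<zeta> \<and> a - alpha_minus \<Omega> \<zeta> < pi" for a
    have ap: "alpha_plus \<Omega> \<zeta> = (THE a. P a)" by (simp add: alpha_plus_def P_def)
    show ?thesis
    proof (cases "\<exists>a. P a")
      case True
      then obtain a where a: "P a" by blast
      have "b = a" if b: "P b" for b
      proof -
        have "cis b = cis a" using a b by (simp add: P_def)
        then have "cis (b - a) = 1" using cis_divide[of b a] by simp
        then have "sin (b - a) = 0" by (simp add: complex_eq_iff)
        moreover have "- pi < b - a" "b - a < pi" using a b unfolding P_def by linarith+
        ultimately show ?thesis using sin_eq_0_pi[of "b - a"] by simp
      qed
      then have "alpha_plus \<Omega> \<zeta> = a" unfolding ap using a by (intro the_equality)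
      then show ?thesis using a unfolding P_def by linarith
    next
      case False
      then have "P = (\<lambda>_. False)" by auto
      then have "alpha_plus \<Omega> \<zeta> = J" by (simp add: ap J_def)
      moreover have "- pi \<le> alpha_minus \<Omega> \<zeta>" using Arg_bounded by (simp add: alpha_minus_def less_imp_le)
      ultimately show ?thesis by linarith
    qed
  qed
  have "1 - interior_angle \<Omega> \<zeta> / pi \<le> (\<bar>J\<bar> + pi) / pi" for \<zeta>
  proof -
    have "1 - interior_angle \<Omega> \<zeta> / pi = (alpha_plus \<Omega> \<zeta> - alpha_minus \<Omega> \<zeta>) / pi"
      by (simp add: interior_angle_def field_simps)
    then show ?thesis
      using diff[of \<zeta>] by (simp add: divide_right_mono)
  qed
  then show ?thesis by blast
qed

text \<open>The viewing angle from \<open>\<zeta> = \<gamma> \<tau>\<close> is controlled on one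
  full turn after \<open>\<tau>\<close> and, by periodicity, on one before it. Together they cover
  the parameters between 0 and \<open>2 * pi\<close> other than \<open>\<tau>\<close>, where the
  density is 0 by definition; each contributes at most \<open>2 * pi\<close>.\<close>

lemma nn_integral_np_density_bounded:
  "\<exists>C. \<forall>\<zeta>\<in>frontier \<Omega>. (\<integral>\<^sup>+\<sigma>. ennreal (np_density \<Omega> \<zeta> \<sigma>) \<partial>arclength \<Omega>) \<le> ennreal C"
proof -
  obtain L where L: "L \<ge> 0" "\<And>s t. dist (\<gamma> s) (\<gamma> t) \<le> L * \<bar>s - t\<bar>" using curve_Lipschitz by blast
  obtain a where a: "a > 0" "\<And>t. a \<le> rad t" using rad_bounds by metis
  define F where "F t = curve_length \<gamma> 0 (max 0 (min t (2 * pi)))" for t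
  have F: "F x \<le> F y" "F y - F x \<le> L * (max 0 (min y (2 * pi)) - max 0 (min x (2 * pi)))" if "x \<le> y" for x y
    unfolding F_def using that by (auto intro!: curve_length_Lipschitz L(2))
  have "(\<integral>\<^sup>+\<sigma>. ennreal (np_density \<Omega> \<zeta> \<sigma>) \<partial>arclength \<Omega>) \<le> ennreal (L * (1 / (pi * a)) * (4 * pi))"
    if \<zeta>: "\<zeta> \<in> frontier \<Omega>" for \<zeta>
  proof -
    have "\<zeta> \<in> \<gamma> ` {0..<2 * pi}"
      using bij_betw_imp_surj_on[OF bij_betw_boundary_curve[OF compact convex interior]] \<zeta> by simp
    then obtain \<tau> where \<tau>: "\<tau> \<in> {0..<2 * pi}" "\<zeta> = \<gamma> \<tau>" by blast
    have \<zeta>': "\<zeta> = \<gamma> (\<tau> - 2 * pi)" using curve_periodic[of "\<tau> - 2 * pi"] \<tau>(2) by simp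
    obtain G1 where G1: "G1 \<in> borel_measurable lborel" "(\<integral>\<^sup>+t. G1 t \<partial>lborel) \<le> ennreal (2 * pi)"
      "\<And>t v. \<tau> < t \<Longrightarrow> t < \<tau> + 2 * pi \<Longrightarrow> (\<gamma> has_vector_derivative v) (at_right t) \<Longrightarrow>
        ennreal (Im (v / (\<gamma> t - \<zeta>))) \<le> G1 t"
      using turning_dominated[of \<tau>] unfolding \<tau>(2) by metis
    obtain G2 where G2: "G2 \<in> borel_measurable lborel" "(\<integral>\<^sup>+t. G2 t \<partial>lborel) \<le> ennreal (2 * pi)"
      "\<And>t v. \<tau> - 2 * pi < t \<Longrightarrow> t < \<tau> - 2 * pi + 2 * pi \<Longrightarrow> (\<gamma> has_vector_derivative v) (at_right t) \<Longrightarrow>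
        ennreal (Im (v / (\<gamma> t - \<zeta>))) \<le> G2 t"
      using turning_dominated[of "\<tau> - 2 * pi"] unfolding \<zeta>' by metis
    let ?c = "ennreal L * ennreal (1 / (pi * a))"
    \<comment> \<open>The indicator includes \<open>2 * pi\<close>, which lies outside the range on
      which \<open>boundary_param\<close> inverts the curve; this single parameter is null for
      Lebesgue measure.\<close>
    have pointwise: "ennreal L * indicator {0<..2 * pi} t * ennreal (np_density \<Omega> \<zeta> (\<gamma> t)) \<le> ?c * (G1 t + G2 t)"
      if t: "t \<noteq> 2 * pi" for t
    proof (cases "t \<in> {0<..<2 * pi} \<and> t \<noteq> \<tau>")
      case True
      obtain v where v: "(\<gamma> has_vector_derivative v) (at_right t)" "rad t \<le> norm v"
        using curve_right_derivative by blast
      have "t \<in> {0..<2 * pi}" using True by auto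
      from np_density_curve_le[OF this a v, of \<zeta>]
      have "ennreal L * ennreal (np_density \<Omega> \<zeta> (\<gamma> t)) \<le> ?c * ennreal (Im (v / (\<gamma> t - \<zeta>)))"
        unfolding mult.assoc by (intro mult_left_mono) auto
      also have "ennreal (Im (v / (\<gamma> t - \<zeta>))) \<le> G1 t + G2 t"
      proof (cases "\<tau> < t")
        case True
        then have "ennreal (Im (v / (\<gamma> t - \<zeta>))) \<le> G1 t"
          using \<open>t \<in> {0..<2 * pi}\<close> \<tau>(1) v(1) by (intro G1(3)) auto
        then show ?thesis by (rule add_increasing2[rotated]) simp
      next
        case False
        then have "ennreal (Im (v / (\<gamma> t - \<zeta>))) \<le> G2 t"
          using \<open>t \<in> {0<..<2 * pi} \<and> t \<noteq> \<tau>\<close> \<tau>(1) v(1) by (intro G2(3)) auto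
        then show ?thesis by (rule add_increasing[rotated]) simp
      qed
      finally show ?thesis using True by (simp add: mult_left_mono)
    next
      case False
      then show ?thesis using t \<tau>(2) by (auto simp: np_density_def split: split_indicator)
    qed
    have "(\<integral>\<^sup>+\<sigma>. ennreal (np_density \<Omega> \<zeta> \<sigma>) \<partial>arclength \<Omega>)
        \<le> (\<integral>\<^sup>+t. ennreal (np_density \<Omega> \<zeta> (\<gamma> t)) \<partial>interval_measure F)"
      unfolding arclength_def F_def[symmetric]
      using measurable_curve by (intro nn_integral_distr_le) simp
    also have "\<dots> \<le> (\<integral>\<^sup>+t. ennreal L * indicator {0<..2 * pi} t * ennreal (np_density \<Omega> \<zeta> (\<gamma> t)) \<partial>lborel)"
      using F L(1) by (intro nn_integral_interval_measure_le) auto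
    also have "\<dots> \<le> (\<integral>\<^sup>+t. ?c * (G1 t + G2 t) \<partial>lborel)"
    proof (rule nn_integral_mono_AE)
      show "AE t in lborel. ennreal L * indicator {0<..2 * pi} t * ennreal (np_density \<Omega> \<zeta> (\<gamma> t)) \<le> ?c * (G1 t + G2 t)"
        using AE_lborel_singleton[of "2 * pi"] pointwise by (auto elim: eventually_mono)
    qed
    also have "\<dots> = ?c * ((\<integral>\<^sup>+t. G1 t \<partial>lborel) + (\<integral>\<^sup>+t. G2 t \<partial>lborel))"
      using G1(1) G2(1) by (simp add: nn_integral_cmult nn_integral_add)
    also have "\<dots> \<le> ?c * (ennreal (2 * pi) + ennreal (2 * pi))"
      by (intro mult_left_mono add_mono G1(2) G2(2)) simp
    also have "\<dots> = ennreal (L * (1 / (pi * a)) * (4 * pi))"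
      using L(1) a(1) by (simp add: ennreal_mult[symmetric] ennreal_plus[symmetric] del: ennreal_plus)
    finally show ?thesis .
  qed
  then show ?thesis by blast
qed

lemma bounded_kernel_np_measure: "\<exists>B. bounded_kernel (frontier \<Omega>) (np_measure \<Omega>) B"
proof -
  obtain C where C: "\<And>\<zeta>. \<zeta> \<in> frontier \<Omega> \<Longrightarrow> (\<integral>\<^sup>+\<sigma>. ennreal (np_density \<Omega> \<zeta> \<sigma>) \<partial>arclength \<Omega>) \<le> ennreal C"
    using nn_integral_np_density_bounded by blast
  obtain K where K: "\<And>\<zeta>. 1 - interior_angle \<Omega> \<zeta> / pi \<le> K" using corner_mass_bounded by blast
  have space: "space (restrict_space borel (frontier \<Omega>)) = frontier \<Omega>" by (simp add: space_restrict_space)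
  have sub: "sets (restrict_space borel (frontier \<Omega>)) \<subseteq> Pow (frontier \<Omega>)"
    using sets.space_closed[of "restrict_space borel (frontier \<Omega>)"] by (simp only: space)
  have "bounded_kernel (frontier \<Omega>) (np_measure \<Omega>) (max K 0 + max C 0)"
  proof
    show "compact (frontier \<Omega>)" by (rule compact_frontier[OF compact])
    show "frontier \<Omega> \<noteq> {}" using curve_in_frontier by blast
    show "sets (np_measure \<Omega> \<zeta>) = sets (restrict_space borel (frontier \<Omega>))" for \<zeta>
      using sets.sigma_sets_eq[of "restrict_space borel (frontier \<Omega>)"] sub
      unfolding np_measure_def space by simp
    fix \<zeta> assume \<zeta>: "\<zeta> \<in> frontier \<Omega>"
    \<comment> \<open>The mass given by \<open>measure_of\<close> is the value of the defining set
      function or 0, so the set function bounds it in either case.\<close>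
    have "emeasure (np_measure \<Omega> \<zeta>) (frontier \<Omega>)
        \<le> ennreal (1 - interior_angle \<Omega> \<zeta> / pi) * indicator (frontier \<Omega>) \<zeta>
          + emeasure (density (arclength \<Omega>) (\<lambda>\<sigma>. ennreal (np_density \<Omega> \<zeta> \<sigma>))) (frontier \<Omega>)"
      unfolding np_measure_def emeasure_measure_of_conv by simp
    also have "\<dots> \<le> ennreal (max K 0) + ennreal (max C 0)"
    proof (rule add_mono)
      show "ennreal (1 - interior_angle \<Omega> \<zeta> / pi) * indicator (frontier \<Omega>) \<zeta> \<le> ennreal (max K 0)"
        using K[of \<zeta>] \<zeta> by (simp add: ennreal_leI)
      have "emeasure (density (arclength \<Omega>) (\<lambda>\<sigma>. ennreal (np_density \<Omega> \<zeta> \<sigma>))) (frontier \<Omega>) \<le> ennreal C"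
        using emeasure_density_le C[OF \<zeta>] by (rule order_trans)
      also have "ennreal C \<le> ennreal (max C 0)" by (rule ennreal_leI) simp
      finally show "emeasure (density (arclength \<Omega>) (\<lambda>\<sigma>. ennreal (np_density \<Omega> \<zeta> \<sigma>))) (frontier \<Omega>)
        \<le> ennreal (max C 0)" .
    qed
    also have "\<dots> = ennreal (max K 0 + max C 0)" by (simp add: ennreal_plus)
    finally show "emeasure (np_measure \<Omega> \<zeta>) (frontier \<Omega>) \<le> ennreal (max K 0 + max C 0)" .
  qed
  then show ?thesis by blast
qed

end

theorem theorem1:
  fixes \<Omega> :: "complex set"
  assumes "compact \<Omega>" and "convex \<Omega>" and "interior \<Omega> \<noteq> {}"
  shows "c_real \<Omega> = c_complex \<Omega>"
proof -
  interpret convex_body \<Omega> by unfold_locales fact+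
  obtain B where "bounded_kernel (frontier \<Omega>) (np_measure \<Omega>) B"
    using bounded_kernel_np_measure by blast
  then interpret kernel: bounded_kernel "frontier \<Omega>" "np_measure \<Omega>" B .
  have "neumann_poincare \<Omega> f = kernel.average f" for f :: "complex \<Rightarrow> real"
    by (rule ext) (simp add: neumann_poincare_def kernel.average_def)
  moreover have "neumann_poincare \<Omega> f = kernel.average f" for f :: "complex \<Rightarrow> complex"
    by (rule ext) (simp add: neumann_poincare_def kernel.average_def)
  ultimately show ?thesis
    unfolding c_real_def c_complex_def by (simp add: kernel.Sup_quotient_norm_average)
qed

end
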